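(* Let $\zeta_0$ be the unique unital character of $U_q(\mathfrak k)$ such that $\zeta_0(\theta)=0$. Define a linear map $\gamma:U_q(\mathfrak g)\to\mathbb K[t,t^{-1}]$ by $$\gamma(xy)=\zeta_0(x)\,\mathrm{ab}(y)\qquad(x\in U_q(\mathfrak k),\ y\in\mathcal O_q(K\backslash U)).$$ Let $\sigma$ be the unique algebra automorphism of $\mathbb K[t,t^{-1}]$ such that $\sigma(t)=q^{-1}t$. Then the restriction of $\tilde\gamma=\sigma\circ\gamma$ to the center $\mathcal Z_q(\mathfrak g)$ of $U_q(\mathfrak g)$ is an algebra isomorphism onto the algebra of Laurent polynomials that are invariant under the transformation $t\mapsto t^{-1}$.
   Context: $\mathbb K$ is an involutive extension of $\mathbb C$: an extension field of $\mathbb C$ equipped with an involutive automorphism restricting to complex conjugation on $\mathbb C$; an element is self-adjoint if it is fixed by the involution. $q\in\mathbb K^\times$ is not a root of unity and has self-adjoint square roots. $U_q(\mathfrak g)$ is the unital associative $\mathbb K$-algebra generated by $X,Y,Z,\theta$ subject to $XZ=q^2ZX$, $ZY=q^2YZ$, $XY+q^2Z^2=1$, $YX+q^{-2}Z^2=1$, $qX\theta-q^{-1}\theta X=q\theta Y-q^{-1}Y\theta=[2]_qZ$, $\theta Z-Z\theta=Y-X$, where $[2]_q=q+q^{-1}$. $U_q(\mathfrak k)=\mathbb K[\theta]$ is the unital subalgebra generated by $\theta$ (a polynomial algebra) and $\mathcal O_q(K\backslash U)$ is the unital subalgebra generated by $X,Y,Z$ (which is presented by the first four relations). Multiplication induces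 a linear isomorphism $U_q(\mathfrak k)\otimes\mathcal O_q(K\backslash U)\to U_q(\mathfrak g)$, so $\gamma$ is well defined. $\mathrm{ab}:\mathcal O_q(K\backslash U)\to\mathbb K[t,t^{-1}]$ is the unique unital algebra morphism with $\mathrm{ab}(X)=t$, $\mathrm{ab}(Y)=t^{-1}$, $\mathrm{ab}(Z)=0$. *)

theory Defs
  imports
    Complex_Main
    "HOL-Library.Poly_Mapping"
    "HOL-Library.FuncSet"
    "HOL-Algebra.Algebraic_Closure_Type"
    "HOL-Algebra.QuotRing"
    "HOL-Algebra.Generated_Rings"
begin

locale involutive_extension =
  fixes emb :: "complex \<Rightarrow> 'k::field" and star :: "'k \<Rightarrow> 'k"
  assumes emb_add: "emb (z + w) = emb z + emb w"
    and emb_mult: "emb (z * w) = emb z * emb w"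
    and emb_one: "emb 1 = 1"
    and star_add: "star (x + y) = star x + star y"
    and star_mult: "star (x * y) = star x * star y"
    and star_star: "star (star x) = x"
    and star_emb: "star (emb z) = emb (cnj z)"


section \<open>Algebras over a field\<close>

text \<open>
  A unital associative algebra over the field \<open>'k\<close> is represented by the library record
  \<^type>\<open>module\<close>, a ring with a scalar multiplication. (The library locale for algebras over a
  ring is not used because it requires commutativity.)
\<close>

definition algebra_of_type :: "('k \<Rightarrow> 'a \<Rightarrow> 'a) \<Rightarrow> ('k, 'a::ring_1) module"
  where "algebra_of_type sc = ring.extend ring_of_type_algebra (module.fields sc)"

definition base_algebra :: "('k, 'k::field) module"
  where "base_algebra = algebra_of_type (*)"

definition quotient_algebra :: "('k, 'a) module \<Rightarrow> 'a set \<Rightarrow> ('k, 'a set) module"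
  where "quotient_algebra A I =
    ring.extend (A Quot I) (module.fields (\<lambda>c S. \<Union>x\<in>S. I +>\<^bsub>A\<^esub> (c \<odot>\<^bsub>A\<^esub> x)))"

definition generated_subalgebra :: "('k, 'a) module \<Rightarrow> 'a set \<Rightarrow> 'a set"
  where "generated_subalgebra A S =
    generate_ring A (S \<union> {c \<odot>\<^bsub>A\<^esub> \<one>\<^bsub>A\<^esub> | c. True})"

definition algebra_center :: "('k, 'a) module \<Rightarrow> 'a set"
  where "algebra_center A =
    {z \<in> carrier A. \<forall>x\<in>carrier A. z \<otimes>\<^bsub>A\<^esub> x = x \<otimes>\<^bsub>A\<^esub> z}"

text \<open>
  Maps are required to be extensional, that is, \<open>undefined\<close> outside the carrier of the source,
  so that maps determined by their values on the carrier are unique as HOL functions.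
\<close>

definition linear_maps :: "('k, 'a) module \<Rightarrow> ('k, 'b) module \<Rightarrow> ('a \<Rightarrow> 'b) set"
  where "linear_maps A B = {f \<in> carrier A \<rightarrow>\<^sub>E carrier B.
    (\<forall>x\<in>carrier A. \<forall>y\<in>carrier A. f (x \<oplus>\<^bsub>A\<^esub> y) = f x \<oplus>\<^bsub>B\<^esub> f y) \<and>
    (\<forall>c. \<forall>x\<in>carrier A. f (c \<odot>\<^bsub>A\<^esub> x) = c \<odot>\<^bsub>B\<^esub> f x)}"

definition algebra_hom :: "('k, 'a) module \<Rightarrow> ('k, 'b) module \<Rightarrow> ('a \<Rightarrow> 'b) set"
  where "algebra_hom A B = linear_maps A B \<inter> ring_hom A B"

definition algebra_iso :: "('k, 'a) module \<Rightarrow> ('k, 'b) module \<Rightarrow> ('a \<Rightarrow> 'b) set"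
  where "algebra_iso A B = {f \<in> algebra_hom A B. bij_betw f (carrier A) (carrier B)}"


section \<open>Free algebras\<close>

datatype 'g word = Word (letters: "'g list")

instantiation word :: (type) monoid_add
begin

definition zero_word :: "'a word"
  where "0 = Word []"

definition plus_word :: "'a word \<Rightarrow> 'a word \<Rightarrow> 'a word"
  where "u + v = Word (letters u @ letters v)"

instance
  by standard (simp_all add: zero_word_def plus_word_def)

end

text \<open>
  The free algebra on \<open>'g\<close> is the monoid algebra of the free monoid of words; its product is
  the convolution product of \<^type>\<open>poly_mapping\<close>. The scalar \<open>c\<close> is
  \<open>Poly_Mapping.single 0 c\<close>.
\<close>

definition free_algebra :: "('k, 'g word \<Rightarrow>\<^sub>0 'k::field) module"
  where "free_algebra = algebra_of_type (\<lambda>c p. Poly_Mapping.single 0 c * p)"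

definition free_gen :: "'g \<Rightarrow> ('g word \<Rightarrow>\<^sub>0 'k::field)"
  where "free_gen g = Poly_Mapping.single (Word [g]) 1"

text \<open>The following lemma ensures that \<^const>\<open>genideal\<close> is meaningful for free algebras.\<close>

lemma ring_free_algebra: "ring (free_algebra :: ('k::field, 'g word \<Rightarrow>\<^sub>0 'k) module)"
proof (intro ringI abelian_groupI monoidI)
  fix p :: "'g word \<Rightarrow>\<^sub>0 'k"
  show "\<exists>r\<in>carrier free_algebra. r \<oplus>\<^bsub>free_algebra\<^esub> p = \<zero>\<^bsub>free_algebra\<^esub>"
    by (rule bexI[of _ "- p"])
      (simp_all add: free_algebra_def algebra_of_type_def ring.defs module.defs
        ring_of_type_algebra_def)
qed (simp_all add: free_algebra_def algebra_of_type_def ring.defs module.defs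
    ring_of_type_algebra_def algebra_simps)


section \<open>The algebra \<open>U\<^sub>q(g)\<close> and its subalgebras\<close>

datatype uq_gen = GX | GY | GZ | GTheta

definition uq_relations :: "'k::field \<Rightarrow> (uq_gen word \<Rightarrow>\<^sub>0 'k) set"
  where "uq_relations q =
   (let s = Poly_Mapping.single 0;
        x = free_gen GX; y = free_gen GY; z = free_gen GZ; \<theta> = free_gen GTheta
    in {x * z - s (q\<^sup>2) * z * x,
        z * y - s (q\<^sup>2) * y * z,
        x * y + s (q\<^sup>2) * z\<^sup>2 - 1,
        y * x + s (inverse (q\<^sup>2)) * z\<^sup>2 - 1,
        s q * x * \<theta> - s (inverse q) * \<theta> * x - s (q + inverse q) * z,
        s q * \<theta> * y - s (inverse q) * y * \<theta> - s (q + inverse q) * z,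
        \<theta> * z - z * \<theta> - (y - x)})"

definition uq_ideal :: "'k::field \<Rightarrow> (uq_gen word \<Rightarrow>\<^sub>0 'k) set"
  where "uq_ideal q = genideal free_algebra (uq_relations q)"

definition Uq_g :: "'k::field \<Rightarrow> ('k, (uq_gen word \<Rightarrow>\<^sub>0 'k) set) module"
  where "Uq_g q = quotient_algebra free_algebra (uq_ideal q)"

definition uq_gen_class :: "'k::field \<Rightarrow> uq_gen \<Rightarrow> (uq_gen word \<Rightarrow>\<^sub>0 'k) set"
  where "uq_gen_class q g = uq_ideal q +>\<^bsub>free_algebra\<^esub> free_gen g"

definition Uq_k :: "'k::field \<Rightarrow> ('k, (uq_gen word \<Rightarrow>\<^sub>0 'k) set) module"
  where "Uq_k q =
    Uq_g q \<lparr>carrier := generated_subalgebra (Uq_g q) {uq_gen_class q GTheta}\<rparr>"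

definition Oq_KU :: "'k::field \<Rightarrow> ('k, (uq_gen word \<Rightarrow>\<^sub>0 'k) set) module"
  where "Oq_KU q = Uq_g q \<lparr>carrier := generated_subalgebra (Uq_g q)
    {uq_gen_class q GX, uq_gen_class q GY, uq_gen_class q GZ}\<rparr>"

definition Zq_g :: "'k::field \<Rightarrow> ('k, (uq_gen word \<Rightarrow>\<^sub>0 'k) set) module"
  where "Zq_g q = Uq_g q \<lparr>carrier := algebra_center (Uq_g q)\<rparr>"


section \<open>Laurent polynomials\<close>

text \<open>
  \<open>K[t, t\<^sup>-\<^sup>1]\<close> is the group algebra of the integers, with \<open>t\<^sup>n\<close> being
  \<open>Poly_Mapping.single n 1\<close>.
\<close>

definition laurent_algebra :: "('k, int \<Rightarrow>\<^sub>0 'k::field) module"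
  where "laurent_algebra = algebra_of_type (\<lambda>c p. Poly_Mapping.single 0 c * p)"

definition laurent_t :: "int \<Rightarrow>\<^sub>0 'k::field"
  where "laurent_t = Poly_Mapping.single 1 1"

definition laurent_t_inv :: "int \<Rightarrow>\<^sub>0 'k::field"
  where "laurent_t_inv = Poly_Mapping.single (-1) 1"

text \<open>The automorphism with \<open>t \<mapsto> u\<close>; only used for \<open>u = q\<^sup>-\<^sup>1 t\<close> and \<open>u = t\<^sup>-\<^sup>1\<close>.\<close>

definition laurent_automorphism :: "(int \<Rightarrow>\<^sub>0 'k::field) \<Rightarrow> (int \<Rightarrow>\<^sub>0 'k) \<Rightarrow> (int \<Rightarrow>\<^sub>0 'k)"
  where "laurent_automorphism u =
    (THE f. f \<in> algebra_iso laurent_algebra laurent_algebra \<and> f laurent_t = u)"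

definition symmetric_laurent_algebra :: "('k, int \<Rightarrow>\<^sub>0 'k::field) module"
  where "symmetric_laurent_algebra =
    laurent_algebra \<lparr>carrier := {p. laurent_automorphism laurent_t_inv p = p}\<rparr>"


section \<open>The map \<open>\<gamma>\<close> and its twist\<close>

definition zeta0 :: "'k::field \<Rightarrow> (uq_gen word \<Rightarrow>\<^sub>0 'k) set \<Rightarrow> 'k"
  where "zeta0 q =
    (THE \<zeta>. \<zeta> \<in> algebra_hom (Uq_k q) base_algebra \<and> \<zeta> (uq_gen_class q GTheta) = 0)"

definition ab :: "'k::field \<Rightarrow> (uq_gen word \<Rightarrow>\<^sub>0 'k) set \<Rightarrow> (int \<Rightarrow>\<^sub>0 'k)"
  where "ab q =
    (THE f. f \<in> algebra_hom (Oq_KU q) laurent_algebra \<and>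
       f (uq_gen_class q GX) = laurent_t \<and>
       f (uq_gen_class q GY) = laurent_t_inv \<and>
       f (uq_gen_class q GZ) = 0)"

definition gamma_map :: "'k::field \<Rightarrow> (uq_gen word \<Rightarrow>\<^sub>0 'k) set \<Rightarrow> (int \<Rightarrow>\<^sub>0 'k)"
  where "gamma_map q =
    (THE g. g \<in> linear_maps (Uq_g q) laurent_algebra \<and>
       (\<forall>x\<in>carrier (Uq_k q). \<forall>y\<in>carrier (Oq_KU q).
          g (x \<otimes>\<^bsub>Uq_g q\<^esub> y) = zeta0 q x \<odot>\<^bsub>laurent_algebra\<^esub> ab q y))"

definition sigma_map :: "'k::field \<Rightarrow> (int \<Rightarrow>\<^sub>0 'k) \<Rightarrow> (int \<Rightarrow>\<^sub>0 'k)"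
  where "sigma_map q = laurent_automorphism (Poly_Mapping.single 0 (inverse q) * laurent_t)"

definition gamma_tilde :: "'k::field \<Rightarrow> (uq_gen word \<Rightarrow>\<^sub>0 'k) set \<Rightarrow> (int \<Rightarrow>\<^sub>0 'k)"
  where "gamma_tilde q = sigma_map q \<circ> gamma_map q"

end

theory Submission
  imports Defs
begin

text \<open>
  Write \<open>\<Omega> = q X + q\<^sup>-\<^sup>1 Y + (q - q\<^sup>-\<^sup>1) \<theta> Z\<close> for the Casimir element (\<open>Casimir\<close>).
  Everything rests on three facts: \<open>\<Omega>\<close> is central, the centre is the polynomial algebra
  \<open>K[\<Omega>]\<close>, and \<open>\<gamma>\<close> is multiplicative on the centre. Since \<open>\<gamma>(\<Omega>) = q t + q\<^sup>-\<^sup>1 t\<^sup>-\<^sup>1\<close>, the twisted map sends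
  \<open>\<Omega>\<close> to \<open>t + t\<^sup>-\<^sup>1\<close>, and the symmetric Laurent polynomials are exactly the polynomials in
  \<open>t + t\<^sup>-\<^sup>1\<close>, freely so: the coefficients can be read off from the top degree downwards.

  The centre is found by embedding the algebra into a quantum torus. Once \<open>X\<close> and \<open>Z\<close> are
  invertible, \<open>Y = X\<^sup>-\<^sup>1 (1 - q\<^sup>2 Z\<^sup>2)\<close> and \<open>\<theta> = (\<Omega> - q X - q\<^sup>-\<^sup>1 Y) Z\<^sup>-\<^sup>1 / (q - q\<^sup>-\<^sup>1)\<close> can be
  expressed by \<open>X\<close>, \<open>Z\<close> and \<open>\<Omega>\<close>, so that the algebra acts by left multiplication on the space with
  basis \<open>Z\<^sup>l X\<^sup>k \<Omega>\<^sup>m\<close>. The monomials \<open>\<theta>\<^sup>n Z\<^sup>a X\<^sup>k\<close> and \<open>\<theta>\<^sup>n Z\<^sup>a Y\<^sup>k\<close> span the algebra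
  (\<open>ex_pbw_sum\<close>), and applied to \<open>1\<close> they have pairwise distinct leading terms
  (\<open>leading_pbw_monomial\<close>). So an element is determined by the vector that it produces from
  \<open>1\<close> (\<open>cong_iff_act_torus_one\<close>). For a central element this vector commutes with \<open>X\<close> and
  \<open>Z\<close>; as \<open>q\<close> is not a root of unity, only the powers of \<open>\<Omega>\<close> commute with both
  (\<open>central_in_Casimir\<close>).

  The map \<open>\<gamma>\<close>, together with \<open>\<zeta>\<^sub>0\<close> and \<open>ab\<close>, is constructed from a right module with
  \<open>1 \<cdot> \<theta> = 0\<close>, modelled on the quotient of the algebra by the right ideal generated by \<open>\<theta>\<close>: one lets an element act on \<open>1\<close> and discards the
  terms that contain \<open>Z\<close> (\<open>gamma_hat\<close>). It satisfies \<open>\<gamma>(\<theta> u) = 0\<close> and \<open>\<gamma>(u y) = \<gamma>(u) \<gamma>(y)\<close> for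
  every \<open>y\<close> in the subalgebra of \<open>X, Y, Z\<close>, and these rules make it the map \<open>\<gamma>\<close> of the statement.
  If \<open>z\<close> is central then \<open>x y z = x z y\<close>, and the same rules give \<open>\<gamma>(x y z) = \<gamma>(x y) \<gamma>(z)\<close>.
\<close>

section \<open>Linear actions of a free algebra\<close>

lemma poly_mapping_add_induct [case_names zero single add]:
  fixes p :: "'a \<Rightarrow>\<^sub>0 'b::comm_monoid_add"
  assumes zero: "P 0" and single: "\<And>a c. P (Poly_Mapping.single a c)"
    and add: "\<And>p p'. P p \<Longrightarrow> P p' \<Longrightarrow> P (p + p')"
  shows "P p"
proof (induction p rule: Poly_Mapping.update_induct)
  case const
  show ?case by (rule zero)
next
  case (update p a b)
  have "Poly_Mapping.update a b p = p + Poly_Mapping.single a b"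
    using update.hyps
    by (intro poly_mapping_eqI)
      (auto simp: lookup_update lookup_add lookup_single not_in_keys_iff_lookup_eq_zero when_def)
  with update single add show ?case by simp
qed

text \<open>
  Products of scalars and monomials have to be normalized in a noncommutative ring. With the
  scalar split off by an operation of its own, the rules below collect all scalars in front.
\<close>

definition smul :: "'k::field \<Rightarrow> ('a::monoid_add \<Rightarrow>\<^sub>0 'k) \<Rightarrow> ('a \<Rightarrow>\<^sub>0 'k)"
  where "smul c p = Poly_Mapping.single 0 c * p"

lemma lookup_smul [simp]: "Poly_Mapping.lookup (smul c p) k = c * Poly_Mapping.lookup p k"
proof -
  have "smul c p = Poly_Mapping.map ((*) c) p"
    by (simp add: smul_def mult_map_scale_conv_mult)
  then show ?thesis by (simp add: Poly_Mapping.map.rep_eq when_def)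
qed

lemma single_0_mult: "Poly_Mapping.single 0 c * p = smul c p"
  by (simp add: smul_def)

lemma smul_mult_left [simp]: "smul c p * p' = smul c (p * p')"
  by (simp add: smul_def mult.assoc)

lemma smul_mult_right [simp]:
  "p * smul c p' = smul c (p * p')"
proof -
  have "p * Poly_Mapping.single 0 c = Poly_Mapping.single 0 c * p"
    by (induction p rule: poly_mapping_add_induct)
      (simp_all add: mult_single algebra_simps)
  then show ?thesis by (simp add: smul_def flip: mult.assoc)
qed

lemma smul_smul [simp]: "smul c (smul d p) = smul (c * d) p"
  by (simp add: smul_def mult_single flip: mult.assoc)

lemma smul_simps [simp]:
  "smul 0 p = 0" "smul c 0 = 0" "smul 1 p = p"
  by (simp_all add: smul_def)

lemma smul_distribs:
  "smul c (p + p') = smul c p + smul c p'"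
  "smul c (p - p') = smul c p - smul c p'"
  "smul c (- p) = - smul c p"
  "smul (c + d) p = smul c p + smul d p"
  "smul (c - d) p = smul c p - smul d p"
  "smul (- c) p = - smul c p"
  by (simp_all add: smul_def single_add single_diff algebra_simps single_uminus)

lemma smul_single: "smul c (Poly_Mapping.single a d) = Poly_Mapping.single a (c * d)"
  by (simp add: smul_def mult_single)

lemma smul_sum: "smul d (\<Sum>s\<in>S. g s) = (\<Sum>s\<in>S. smul d (g s))"
  by (simp add: smul_def sum_distrib_left)

text \<open>
  A polynomial with coefficients \<open>d 0, \<dots>, d (N - 1)\<close>, evaluated at \<open>u\<close>; it is used both in the
  free algebra, at the Casimir element, and in the commutative algebra of Laurent polynomials.
\<close>

definition poly_at :: "('a::monoid_add \<Rightarrow>\<^sub>0 'k::field) \<Rightarrow> nat \<Rightarrow> (nat \<Rightarrow> 'k) \<Rightarrow> ('a \<Rightarrow>\<^sub>0 'k)"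
  where "poly_at u N d = (\<Sum>m<N. smul (d m) (u ^ m))"

lemma poly_at_0 [simp]: "poly_at u 0 d = 0"
  by (simp add: poly_at_def)

lemma poly_at_Suc: "poly_at u (Suc N) d = poly_at u N d + smul (d N) (u ^ N)"
  by (simp add: poly_at_def)

definition linear_op :: "(('s \<Rightarrow> 'k::field) \<Rightarrow> ('t \<Rightarrow> 'k)) \<Rightarrow> bool"
  where "linear_op T \<longleftrightarrow>
    (\<forall>f g. T (\<lambda>s. f s + g s) = (\<lambda>s. T f s + T g s)) \<and>
    (\<forall>c f. T (\<lambda>s. c * f s) = (\<lambda>s. c * T f s))"

text \<open>
  Operators \<open>T g\<close> for the generators extend uniquely to an action of the free algebra. The
  modules below consist of all functions on an index set, of arbitrary support, so that the
  operators can be given by pointwise formulas.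
\<close>

definition act ::
    "('g \<Rightarrow> ('s \<Rightarrow> 'k) \<Rightarrow> ('s \<Rightarrow> 'k)) \<Rightarrow> ('g word \<Rightarrow>\<^sub>0 'k::field) \<Rightarrow> ('s \<Rightarrow> 'k) \<Rightarrow> 's \<Rightarrow> 'k"
  where "act T p f s =
    (\<Sum>w\<in>Poly_Mapping.keys p. Poly_Mapping.lookup p w * foldr T (letters w) f s)"

lemma act_superset:
  assumes "finite A" "Poly_Mapping.keys p \<subseteq> A"
  shows "act T p f s = (\<Sum>w\<in>A. Poly_Mapping.lookup p w * foldr T (letters w) f s)"
  unfolding act_def using assms
  by (intro sum.mono_neutral_left) (auto simp: not_in_keys_iff_lookup_eq_zero)

lemma act_zero: "act T 0 f = (\<lambda>s. 0)"
  by (rule ext) (simp add: act_def)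

lemma act_add: "act T (p + p') f = (\<lambda>s. act T p f s + act T p' f s)"
proof
  fix s
  let ?A = "Poly_Mapping.keys p \<union> Poly_Mapping.keys p'"
  have "Poly_Mapping.keys (p + p') \<subseteq> ?A"
    by (rule Poly_Mapping.keys_add)
  then show "act T (p + p') f s = act T p f s + act T p' f s"
    by (simp add: act_superset[where A = ?A] lookup_add distrib_right sum.distrib)
qed

lemma act_single: "act T (Poly_Mapping.single w c) f = (\<lambda>s. c * foldr T (letters w) f s)"
  by (rule ext) (simp add: act_def)

lemma act_one: "act T 1 f = f"
  by (simp add: act_single zero_word_def flip: single_one)

lemma act_free_gen: "act T (free_gen g) f = T g f"
  by (simp add: free_gen_def act_single)

lemma act_smul: "act T (smul c p) f = (\<lambda>s. c * act T p f s)"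
  by (induction p rule: poly_mapping_add_induct)
    (simp_all add: act_zero smul_single act_single act_add smul_distribs distrib_left mult.assoc)

lemma act_minus: "act T (- p) f = (\<lambda>s. - act T p f s)"
  using act_smul[of T "-1" p f] by (simp add: smul_distribs)

lemma act_diff: "act T (p - p') f = (\<lambda>s. act T p f s - act T p' f s)"
  using act_add[of T p "- p'" f] by (simp add: act_minus)

lemma act_sum: "act T (\<Sum>i\<in>S. g i) f = (\<lambda>s. \<Sum>i\<in>S. act T (g i) f s)"
  by (induction S rule: infinite_finite_induct) (simp_all add: act_zero act_add)

lemma linear_op_foldr:
  assumes "\<And>g. linear_op (T g)"
  shows "linear_op (foldr T gs)"
  using assms by (induction gs) (auto simp: linear_op_def)

lemma linear_op_act:
  assumes "\<And>g. linear_op (T g)"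
  shows "linear_op (act T p)"
proof (induction p rule: poly_mapping_add_induct)
  case zero
  then show ?case by (simp add: linear_op_def act_zero)
next
  case (single w c)
  then show ?case using linear_op_foldr[where T = T and gs = "letters w", OF assms]
    by (simp add: linear_op_def act_single algebra_simps)
next
  case (add p p')
  then show ?case by (simp add: linear_op_def act_add algebra_simps)
qed

lemma linear_op_zero: "linear_op T \<Longrightarrow> T (\<lambda>s. 0) = (\<lambda>s. 0)"
  unfolding linear_op_def by (drule conjunct2, drule spec[of _ 0], drule spec[of _ "\<lambda>s. 0"]) simp

lemma linear_op_simps:
  assumes "linear_op T"
  shows "T (\<lambda>s. f s + g s) s = T f s + T g s"
    and "T (\<lambda>s. f s - g s) s = T f s - T g s"
    and "T (\<lambda>s. c * f s) s = c * T f s"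
    and "T (\<lambda>s. f s / c) s = T f s / c"
proof -
  have add: "T (\<lambda>s. f s + g s) = (\<lambda>s. T f s + T g s)" for f g
    using assms by (simp add: linear_op_def)
  have mult: "T (\<lambda>s. c * f s) = (\<lambda>s. c * T f s)" for c f
    using assms by (simp add: linear_op_def)
  show "T (\<lambda>s. f s + g s) s = T f s + T g s" by (simp add: add)
  show "T (\<lambda>s. f s - g s) s = T f s - T g s"
    using add[of f "\<lambda>s. - 1 * g s"] by (simp only: mult) simp
  show "T (\<lambda>s. c * f s) s = c * T f s" by (simp add: mult)
  show "T (\<lambda>s. f s / c) s = T f s / c"
    using mult[of "inverse c" f] by (simp add: field_simps)
qed


lemma act_mult:
  assumes "\<And>g. linear_op (T g)"
  shows "act T (p * p') f = act T p (act T p' f)"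
proof (induction p rule: poly_mapping_add_induct)
  case zero
  show ?case by (simp add: act_zero)
next
  case (add p1 p2)
  then show ?case by (simp add: act_add distrib_right)
next
  case (single w c)
  note lin = linear_op_foldr[where T = T and gs = "letters w", OF assms]
  show ?case
  proof (induction p' rule: poly_mapping_add_induct)
    case zero
    then show ?case by (simp add: act_zero act_single linear_op_zero[OF lin])
  next
    case (add p1 p2)
    then show ?case using lin
      by (simp add: act_add distrib_left act_single linear_op_def)
  next
    case (single w' c')
    then show ?case using lin
      by (simp add: act_single mult_single plus_word_def linear_op_def mult.assoc)
  qed
qed

lemma act_commute:
  assumes "linear_op R" and "\<And>g f. T g (R f) = R (T g f)"
  shows "act T p (R f) = R (act T p f)"
proof -
  have *: "foldr T gs (R f) = R (foldr T gs f)" for gs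
    by (induction gs) (simp_all add: assms(2))
  show ?thesis
    by (induction p rule: poly_mapping_add_induct)
      (use assms(1) in \<open>simp_all add: act_zero act_add act_single * linear_op_zero linear_op_def\<close>)
qed

section \<open>The defining ideal\<close>

lemma free_algebra_simps:
  "carrier free_algebra = UNIV"
  "x \<otimes>\<^bsub>free_algebra\<^esub> y = x * y"
  "x \<oplus>\<^bsub>free_algebra\<^esub> y = x + y"
  "\<one>\<^bsub>free_algebra\<^esub> = 1"
  "\<zero>\<^bsub>free_algebra\<^esub> = 0"
  "c \<odot>\<^bsub>free_algebra\<^esub> x = smul c x"
  by (simp_all add: free_algebra_def algebra_of_type_def ring.defs module.defs
        ring_of_type_algebra_def smul_def)

lemma free_algebra_a_inv: "\<ominus>\<^bsub>free_algebra\<^esub> x = - (x :: 'g word \<Rightarrow>\<^sub>0 'k::field)"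
proof -
  interpret ring "free_algebra :: ('k, 'g word \<Rightarrow>\<^sub>0 'k) module" by (rule ring_free_algebra)
  show ?thesis
    by (rule minus_equality) (simp_all add: free_algebra_simps)
qed

lemma ideal_uq_ideal: "ideal (uq_ideal q) free_algebra"
  unfolding uq_ideal_def
  by (rule ring.genideal_ideal[OF ring_free_algebra]) (simp add: free_algebra_simps)

lemma uq_ideal_closed:
  shows uq_ideal_0: "0 \<in> uq_ideal q"
    and uq_ideal_add: "x \<in> uq_ideal q \<Longrightarrow> y \<in> uq_ideal q \<Longrightarrow> x + y \<in> uq_ideal q"
    and uq_ideal_minus: "x \<in> uq_ideal q \<Longrightarrow> - x \<in> uq_ideal q"
    and uq_ideal_mult_left: "x \<in> uq_ideal q \<Longrightarrow> p * x \<in> uq_ideal q"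
    and uq_ideal_mult_right: "x \<in> uq_ideal q \<Longrightarrow> x * p \<in> uq_ideal q"
proof -
  interpret I: ideal "uq_ideal q" free_algebra by (rule ideal_uq_ideal)
  show "0 \<in> uq_ideal q"
    using additive_subgroup.zero_closed[OF I.additive_subgroup_axioms] by (simp add: free_algebra_simps)
  show "x \<in> uq_ideal q \<Longrightarrow> y \<in> uq_ideal q \<Longrightarrow> x + y \<in> uq_ideal q"
    using additive_subgroup.a_closed[OF I.additive_subgroup_axioms] by (simp add: free_algebra_simps)
  show "x \<in> uq_ideal q \<Longrightarrow> - x \<in> uq_ideal q"
    using additive_subgroup.a_inv_closed[OF I.additive_subgroup_axioms]
    by (simp add: free_algebra_simps free_algebra_a_inv)
  show "x \<in> uq_ideal q \<Longrightarrow> p * x \<in> uq_ideal q"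
    using I.I_l_closed[of x p] by (simp add: free_algebra_simps)
  show "x \<in> uq_ideal q \<Longrightarrow> x * p \<in> uq_ideal q"
    using I.I_r_closed[of x p] by (simp add: free_algebra_simps)
qed

lemma uq_ideal_diff: "x \<in> uq_ideal q \<Longrightarrow> y \<in> uq_ideal q \<Longrightarrow> x - y \<in> uq_ideal q"
  using uq_ideal_add[of x q "- y"] by (simp add: uq_ideal_minus)

lemma uq_ideal_smul: "x \<in> uq_ideal q \<Longrightarrow> smul c x \<in> uq_ideal q"
  unfolding smul_def by (rule uq_ideal_mult_left)

text \<open>
  The elements that act as zero form a two-sided ideal. So a family of operators that satisfies the
  defining relations gives a module over the quotient.
\<close>

lemma act_uq_ideal:
  assumes lin: "\<And>g. linear_op (T g)"
    and rel: "\<And>r f. r \<in> uq_relations q \<Longrightarrow> act T r f = (\<lambda>s. 0)"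
    and p: "p \<in> uq_ideal q"
  shows "act T p f = (\<lambda>s. 0)"
proof -
  let ?K = "{p. \<forall>f. act T p f = (\<lambda>s. 0)}"
  interpret R: ring free_algebra by (rule ring_free_algebra)
  have "ideal ?K free_algebra"
  proof (rule idealI[OF ring_free_algebra])
    show "subgroup ?K (add_monoid free_algebra)"
      by (rule R.add.subgroupI)
        (auto simp: free_algebra_simps free_algebra_a_inv
          act_add act_minus simp flip: a_inv_def intro!: exI[of _ 0] act_zero)
  qed (auto simp: free_algebra_simps act_mult[OF lin] linear_op_zero[OF linear_op_act[OF lin]])
  then have "uq_ideal q \<subseteq> ?K"
    unfolding uq_ideal_def by (rule R.genideal_minimal) (use rel in auto)
  then show ?thesis using p by auto
qed

section \<open>Spanning by ordered monomials\<close>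

locale uq =
  fixes q :: "'k::field"
  assumes q_nonzero [simp]: "q \<noteq> 0"
    and q_not_root_of_unity: "\<And>n::nat. n > 0 \<Longrightarrow> q ^ n \<noteq> 1"
begin

abbreviation gX :: "uq_gen word \<Rightarrow>\<^sub>0 'k" where "gX \<equiv> free_gen GX"
abbreviation gY :: "uq_gen word \<Rightarrow>\<^sub>0 'k" where "gY \<equiv> free_gen GY"
abbreviation gZ :: "uq_gen word \<Rightarrow>\<^sub>0 'k" where "gZ \<equiv> free_gen GZ"
abbreviation gTheta :: "uq_gen word \<Rightarrow>\<^sub>0 'k" where "gTheta \<equiv> free_gen GTheta"

definition cong :: "(uq_gen word \<Rightarrow>\<^sub>0 'k) \<Rightarrow> (uq_gen word \<Rightarrow>\<^sub>0 'k) \<Rightarrow> bool"  (infix "\<cong>\<^sub>q" 50)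
  where "p \<cong>\<^sub>q p' \<longleftrightarrow> p - p' \<in> uq_ideal q"

lemma cong_refl [simp, intro]: "p \<cong>\<^sub>q p"
  by (simp add: cong_def uq_ideal_0)

lemma cong_sym: "p \<cong>\<^sub>q p' \<Longrightarrow> p' \<cong>\<^sub>q p"
  unfolding cong_def using uq_ideal_minus by fastforce

lemma cong_trans [trans]: "p \<cong>\<^sub>q p' \<Longrightarrow> p' \<cong>\<^sub>q p'' \<Longrightarrow> p \<cong>\<^sub>q p''"
  unfolding cong_def using uq_ideal_add[of "p - p'" q "p' - p''"] by simp

lemma cong_add: "p \<cong>\<^sub>q p' \<Longrightarrow> r \<cong>\<^sub>q r' \<Longrightarrow> p + r \<cong>\<^sub>q p' + r'"
  unfolding cong_def using uq_ideal_add[of "p - p'" q "r - r'"] by (simp add: algebra_simps)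

lemma cong_diff: "p \<cong>\<^sub>q p' \<Longrightarrow> r \<cong>\<^sub>q r' \<Longrightarrow> p - r \<cong>\<^sub>q p' - r'"
  unfolding cong_def using uq_ideal_diff[of "p - p'" q "r - r'"] by (simp add: algebra_simps)

lemma cong_smul: "p \<cong>\<^sub>q p' \<Longrightarrow> smul c p \<cong>\<^sub>q smul c p'"
  unfolding cong_def using uq_ideal_smul[of "p - p'" q c] by (simp add: smul_distribs)

lemma cong_mult_left: "p \<cong>\<^sub>q p' \<Longrightarrow> r * p \<cong>\<^sub>q r * p'"
  unfolding cong_def using uq_ideal_mult_left[of "p - p'" q r] by (simp add: right_diff_distrib)

lemma cong_mult_right: "p \<cong>\<^sub>q p' \<Longrightarrow> p * r \<cong>\<^sub>q p' * r"
  unfolding cong_def using uq_ideal_mult_right[of "p - p'" q r] by (simp add: left_diff_distrib)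

lemma relations_eq:
  "uq_relations q =
    {gX * gZ - smul (q\<^sup>2) (gZ * gX), gZ * gY - smul (q\<^sup>2) (gY * gZ),
     gX * gY + smul (q\<^sup>2) (gZ * gZ) - 1, gY * gX + smul (inverse (q\<^sup>2)) (gZ * gZ) - 1,
     smul q (gX * gTheta) - smul (inverse q) (gTheta * gX) - smul (q + inverse q) gZ,
     smul q (gTheta * gY) - smul (inverse q) (gY * gTheta) - smul (q + inverse q) gZ,
     gTheta * gZ - gZ * gTheta - (gY - gX)}"
  unfolding uq_relations_def Let_def by (simp only: single_0_mult smul_mult_left power2_eq_square)

lemma relation_cong: "r - r' \<in> uq_relations q \<Longrightarrow> r \<cong>\<^sub>q r'"
proof -
  have "uq_relations q \<subseteq> uq_ideal q"
    unfolding uq_ideal_def by (rule ring.genideal_self[OF ring_free_algebra]) (simp add: free_algebra_simps)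
  then show "r - r' \<in> uq_relations q \<Longrightarrow> r \<cong>\<^sub>q r'" by (auto simp: cong_def)
qed

lemma X_Z: "gX * gZ \<cong>\<^sub>q smul (q\<^sup>2) (gZ * gX)"
  by (rule relation_cong) (simp add: relations_eq)

lemma Y_Z: "gY * gZ \<cong>\<^sub>q smul (inverse (q\<^sup>2)) (gZ * gY)"
proof -
  have "gZ * gY \<cong>\<^sub>q smul (q\<^sup>2) (gY * gZ)"
    by (rule relation_cong) (simp add: relations_eq)
  from cong_smul[OF this, of "inverse (q\<^sup>2)"] show ?thesis
    by (simp add: cong_sym)
qed

lemma X_Y: "gX * gY \<cong>\<^sub>q 1 - smul (q\<^sup>2) (gZ * gZ)"
  by (rule relation_cong) (simp add: relations_eq)

lemma Y_X: "gY * gX \<cong>\<^sub>q 1 - smul (inverse (q\<^sup>2)) (gZ * gZ)"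
  by (rule relation_cong) (simp add: relations_eq)

lemma X_Theta: "gX * gTheta \<cong>\<^sub>q smul (inverse (q\<^sup>2)) (gTheta * gX) + smul (1 + inverse (q\<^sup>2)) gZ"
proof -
  have "smul q (gX * gTheta) \<cong>\<^sub>q smul (inverse q) (gTheta * gX) + smul (q + inverse q) gZ"
    by (rule relation_cong) (simp add: relations_eq)
  from cong_smul[OF this, of "inverse q"] show ?thesis
    by (simp add: smul_distribs power2_eq_square distrib_left)
qed

lemma Y_Theta: "gY * gTheta \<cong>\<^sub>q smul (q\<^sup>2) (gTheta * gY) - smul (q\<^sup>2 + 1) gZ"
proof -
  have "smul q (gTheta * gY) \<cong>\<^sub>q smul (inverse q) (gY * gTheta) + smul (q + inverse q) gZ"
    by (rule relation_cong) (simp add: relations_eq)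
  from cong_diff[OF cong_smul[OF this, of q] cong_refl[of "smul (q * (q + inverse q)) gZ"]] show ?thesis
    by (simp add: smul_distribs power2_eq_square distrib_left cong_sym)
qed

lemma Z_Theta: "gZ * gTheta \<cong>\<^sub>q gTheta * gZ + gX - gY"
proof -
  have "gTheta * gZ - gZ * gTheta \<cong>\<^sub>q gY - gX"
    by (rule relation_cong) (simp add: relations_eq)
  from cong_diff[OF cong_refl[of "gTheta * gZ"] this] show ?thesis
    by (simp add: algebra_simps)
qed

text \<open>
  \<open>X\<close> and \<open>Y\<close> commute with \<open>Z\<close> up to a scalar, hence also with its powers.
\<close>

lemma commute_Z_power:
  assumes "h * gZ \<cong>\<^sub>q smul c (gZ * h)"
  shows "h * gZ ^ a \<cong>\<^sub>q smul (c ^ a) (gZ ^ a * h)"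
proof (induction a)
  case (Suc a)
  have "h * gZ ^ Suc a = (h * gZ) * gZ ^ a" by (simp add: mult.assoc)
  also have "\<dots> \<cong>\<^sub>q smul c (gZ * h) * gZ ^ a" by (rule cong_mult_right[OF assms])
  also have "\<dots> = smul c (gZ * (h * gZ ^ a))" by (simp add: mult.assoc)
  also have "\<dots> \<cong>\<^sub>q smul c (gZ * smul (c ^ a) (gZ ^ a * h))"
    by (intro cong_smul cong_mult_left Suc)
  finally show ?case by (simp add: mult.assoc)
qed simp

text \<open>
  As \<open>X Y\<close> and \<open>Y X\<close> are polynomials in \<open>Z\<close>, a basis needs no monomials with both \<open>X\<close> and \<open>Y\<close>.
  The powers of \<open>Y\<close> take the place of the negative powers of \<open>X\<close>.
\<close>

definition xy_power :: "int \<Rightarrow> (uq_gen word \<Rightarrow>\<^sub>0 'k)"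
  where "xy_power k = (if k \<ge> 0 then gX ^ nat k else gY ^ nat (- k))"

lemma xy_power_0: "xy_power 0 = 1" by (simp add: xy_power_def)

lemma xy_power_pos: "k > 0 \<Longrightarrow> xy_power k = gX * xy_power (k - 1)"
proof -
  assume "k > 0"
  then have "nat k = Suc (nat (k - 1))" by simp
  with \<open>k > 0\<close> show ?thesis by (simp add: xy_power_def)
qed

lemma xy_power_neg: "k < 0 \<Longrightarrow> xy_power k = gY * xy_power (k + 1)"
proof -
  assume "k < 0"
  then have "nat (- k) = Suc (nat (- (k + 1)))" by simp
  with \<open>k < 0\<close> show ?thesis by (auto simp: xy_power_def)
qed

definition pbw_monomial :: "nat \<times> nat \<times> int \<Rightarrow> (uq_gen word \<Rightarrow>\<^sub>0 'k)"
  where "pbw_monomial = (\<lambda>(n, a, k). gTheta ^ n * (gZ ^ a * xy_power k))"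

inductive_set pbw_span :: "(uq_gen word \<Rightarrow>\<^sub>0 'k) set"
  where basis: "pbw_monomial s \<in> pbw_span"
  | add: "p \<in> pbw_span \<Longrightarrow> p' \<in> pbw_span \<Longrightarrow> p + p' \<in> pbw_span"
  | scale: "p \<in> pbw_span \<Longrightarrow> smul c p \<in> pbw_span"
  | congruent: "p \<in> pbw_span \<Longrightarrow> p' \<cong>\<^sub>q p \<Longrightarrow> p' \<in> pbw_span"

lemma pbw_span_diff: "p \<in> pbw_span \<Longrightarrow> p' \<in> pbw_span \<Longrightarrow> p - p' \<in> pbw_span"
  using pbw_span.add[OF _ pbw_span.scale[of p' "-1"], of p] by (simp add: smul_distribs)

lemma pbw_span_left_mult:
  assumes "\<And>s. h * pbw_monomial s \<in> pbw_span" and "p \<in> pbw_span"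
  shows "h * p \<in> pbw_span"
  using assms(2)
  by induction (auto simp: assms(1) distrib_left intro: pbw_span.intros cong_mult_left)

lemma Theta_pbw_span: "p \<in> pbw_span \<Longrightarrow> gTheta * p \<in> pbw_span"
proof (rule pbw_span_left_mult)
  fix s :: "nat \<times> nat \<times> int"
  obtain n a k where s: "s = (n, a, k)" by (cases s)
  have "gTheta * pbw_monomial s = pbw_monomial (Suc n, a, k)" by (simp add: s pbw_monomial_def mult.assoc)
  then show "gTheta * pbw_monomial s \<in> pbw_span" by (simp add: pbw_span.basis)
qed

lemma X_xy_power: "gX * xy_power k \<cong>\<^sub>q
  (if k \<ge> 0 then xy_power (k + 1) else xy_power (k + 1) - smul (q\<^sup>2) (gZ ^ 2 * xy_power (k + 1)))"
proof (cases "k \<ge> 0")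
  case True
  then show ?thesis using xy_power_pos[of "k + 1"] by simp
next
  case False
  then have "gX * xy_power k = (gX * gY) * xy_power (k + 1)" using xy_power_neg[of k] by (simp add: mult.assoc)
  also have "\<dots> \<cong>\<^sub>q (1 - smul (q\<^sup>2) (gZ * gZ)) * xy_power (k + 1)" by (rule cong_mult_right[OF X_Y])
  finally show ?thesis using False by (simp add: left_diff_distrib power2_eq_square)
qed

lemma Y_xy_power: "gY * xy_power k \<cong>\<^sub>q
  (if k \<le> 0 then xy_power (k - 1) else xy_power (k - 1) - smul (inverse (q\<^sup>2)) (gZ ^ 2 * xy_power (k - 1)))"
proof (cases "k \<le> 0")
  case True
  then show ?thesis using xy_power_neg[of "k - 1"] by simp
next
  case False
  then have "gY * xy_power k = (gY * gX) * xy_power (k - 1)" using xy_power_pos[of k] by (simp add: mult.assoc)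
  also have "\<dots> \<cong>\<^sub>q (1 - smul (inverse (q\<^sup>2)) (gZ * gZ)) * xy_power (k - 1)" by (rule cong_mult_right[OF Y_X])
  finally show ?thesis using False by (simp add: left_diff_distrib power2_eq_square)
qed

lemma Z_power_xy_power_pbw_span: "gZ ^ a * xy_power k \<in> pbw_span"
  using pbw_span.basis[of "(0, a, k)"] by (simp add: pbw_monomial_def)

text \<open>
  Common to \<open>h = X\<close> and \<open>h = Y\<close>: move \<open>h\<close> past the power of \<open>Z\<close>, then absorb it into the power of
  \<open>X\<close> or \<open>Y\<close>, which costs at most a factor \<open>1 - d Z\<^sup>2\<close>.
\<close>

lemma generator_mult_pbw_span:
  assumes "h * gZ \<cong>\<^sub>q smul c (gZ * h)"
    and "h * xy_power k \<cong>\<^sub>q (if P then xy_power k' else xy_power k' - smul d (gZ ^ 2 * xy_power k'))"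
  shows "h * (gZ ^ a * xy_power k) \<in> pbw_span"
proof -
  have "h * (gZ ^ a * xy_power k) = (h * gZ ^ a) * xy_power k" by (simp add: mult.assoc)
  also have "\<dots> \<cong>\<^sub>q smul (c ^ a) (gZ ^ a * h) * xy_power k"
    by (rule cong_mult_right[OF commute_Z_power[OF assms(1)]])
  also have "\<dots> = smul (c ^ a) (gZ ^ a * (h * xy_power k))" by (simp add: mult.assoc)
  also have "\<dots> \<cong>\<^sub>q smul (c ^ a) (gZ ^ a * (if P then xy_power k' else xy_power k' - smul d (gZ ^ 2 * xy_power k')))"
    by (intro cong_smul cong_mult_left assms(2))
  finally have *: "h * (gZ ^ a * xy_power k) \<cong>\<^sub>q \<dots>" .
  have "gZ ^ a * (gZ ^ 2 * xy_power k') = gZ ^ (a + 2) * xy_power k'" by (simp only: power_add mult.assoc)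
  then have "gZ ^ a * (if P then xy_power k' else xy_power k' - smul d (gZ ^ 2 * xy_power k')) \<in> pbw_span"
    by (simp add: right_diff_distrib pbw_span.scale pbw_span_diff Z_power_xy_power_pbw_span del: power_Suc)
  then show ?thesis
    by (rule pbw_span.congruent[OF pbw_span.scale *])
qed

text \<open>
  Induction on the power of \<open>\<theta>\<close>. Moving a generator past one \<open>\<theta>\<close> gives \<open>\<theta>\<close> times that
  generator and terms in which this \<open>\<theta>\<close> is missing. The latter may involve the other two generators, so
  the claim is proved for all three at once.
\<close>

lemma XYZ_mult_pbw_span:
  "gX * pbw_monomial (n, a, k) \<in> pbw_span \<and> gY * pbw_monomial (n, a, k) \<in> pbw_span \<and>
    gZ * pbw_monomial (n, a, k) \<in> pbw_span"
proof (induction n)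
  case 0
  have "gZ * (gZ ^ a * xy_power k) = gZ ^ Suc a * xy_power k" by (simp add: mult.assoc)
  then have "gZ * (gZ ^ a * xy_power k) \<in> pbw_span" by (simp only: Z_power_xy_power_pbw_span)
  with generator_mult_pbw_span[OF X_Z X_xy_power] generator_mult_pbw_span[OF Y_Z Y_xy_power] show ?case
    by (simp add: pbw_monomial_def)
next
  case (Suc n)
  let ?u = "pbw_monomial (n, a, k)"
  have step: "pbw_monomial (Suc n, a, k) = gTheta * ?u" by (simp add: pbw_monomial_def mult.assoc)
  have X: "gX * (gTheta * ?u) \<cong>\<^sub>q smul (inverse (q\<^sup>2)) (gTheta * (gX * ?u)) + smul (1 + inverse (q\<^sup>2)) (gZ * ?u)"
    using cong_mult_right[OF X_Theta, of ?u] by (simp add: mult.assoc distrib_right)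
  have Y: "gY * (gTheta * ?u) \<cong>\<^sub>q smul (q\<^sup>2) (gTheta * (gY * ?u)) - smul (q\<^sup>2 + 1) (gZ * ?u)"
    using cong_mult_right[OF Y_Theta, of ?u] by (simp add: mult.assoc left_diff_distrib)
  have Z: "gZ * (gTheta * ?u) \<cong>\<^sub>q gTheta * (gZ * ?u) + gX * ?u - gY * ?u"
    using cong_mult_right[OF Z_Theta, of ?u] by (simp add: mult.assoc algebra_simps)
  note closed = pbw_span.add pbw_span.scale pbw_span_diff Theta_pbw_span
  show ?case unfolding step using Suc
    by (intro conjI pbw_span.congruent[OF _ X] pbw_span.congruent[OF _ Y] pbw_span.congruent[OF _ Z] closed)
      simp_all
qed

lemma single_Word_Cons:
  "Poly_Mapping.single (Word (g # gs)) (c::'k) = free_gen g * Poly_Mapping.single (Word gs) c"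
  by (simp add: free_gen_def mult_single plus_word_def)

text \<open>
  The span is closed under left multiplication by the generators and contains \<open>1\<close>.
\<close>

lemma pbw_span_UNIV: "p \<in> pbw_span"
proof -
  have gen: "free_gen g * p \<in> pbw_span" if "p \<in> pbw_span" for g p
    by (cases g) (use XYZ_mult_pbw_span Theta_pbw_span that in \<open>auto intro: pbw_span_left_mult\<close>)
  have one: "(1 :: uq_gen word \<Rightarrow>\<^sub>0 'k) \<in> pbw_span"
    using pbw_span.basis[of "(0, 0, 0)"] by (simp add: pbw_monomial_def xy_power_0)
  have word: "Poly_Mapping.single (Word gs) c \<in> pbw_span" for gs :: "uq_gen list" and c
  proof (induction gs)
    case Nil
    then show ?case
      using pbw_span.scale[OF one, of c] by (simp add: smul_single zero_word_def flip: single_one)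
  next
    case (Cons g gs)
    then show ?case by (simp add: single_Word_Cons gen)
  qed
  show ?thesis
  proof (induction p rule: poly_mapping_add_induct)
    case zero
    then show ?case using pbw_span.scale[OF one, of 0] by simp
  next
    case (single w c)
    then show ?case using word[of "letters w" c] by simp
  qed (rule pbw_span.add)
qed

definition pbw_sum :: "(nat \<times> nat \<times> int \<Rightarrow>\<^sub>0 'k) \<Rightarrow> (uq_gen word \<Rightarrow>\<^sub>0 'k)"
  where "pbw_sum c = (\<Sum>s\<in>Poly_Mapping.keys c. smul (Poly_Mapping.lookup c s) (pbw_monomial s))"

lemma pbw_sum_superset:
  assumes "finite S" "Poly_Mapping.keys c \<subseteq> S"
  shows "pbw_sum c = (\<Sum>s\<in>S. smul (Poly_Mapping.lookup c s) (pbw_monomial s))"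
  unfolding pbw_sum_def using assms
  by (intro sum.mono_neutral_left) (auto simp: not_in_keys_iff_lookup_eq_zero)

lemma pbw_sum_add: "pbw_sum (c + c') = pbw_sum c + pbw_sum c'"
proof -
  let ?S = "Poly_Mapping.keys c \<union> Poly_Mapping.keys c'"
  show ?thesis using Poly_Mapping.keys_add[of c c']
    by (simp add: pbw_sum_superset[where S = ?S] lookup_add smul_distribs sum.distrib)
qed

lemma pbw_sum_smul: "pbw_sum (Poly_Mapping.map ((*) d) c) = smul d (pbw_sum c)"
proof -
  have lookup: "Poly_Mapping.lookup (Poly_Mapping.map ((*) d) c) s = d * Poly_Mapping.lookup c s" for s
    by (simp add: Poly_Mapping.map.rep_eq when_def)
  then have "Poly_Mapping.keys (Poly_Mapping.map ((*) d) c) \<subseteq> Poly_Mapping.keys c"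
    by (auto simp: in_keys_iff)
  then show ?thesis unfolding pbw_sum_def[of c]
    by (simp add: pbw_sum_superset[where S = "Poly_Mapping.keys c"] smul_sum lookup)
qed

lemma ex_pbw_sum: "\<exists>c. p \<cong>\<^sub>q pbw_sum c"
  using pbw_span_UNIV[of p]
proof induction
  case (basis s)
  show ?case by (rule exI[of _ "Poly_Mapping.single s 1"]) (simp add: pbw_sum_def)
next
  case (add p p')
  then show ?case by (metis pbw_sum_add cong_add)
next
  case (scale p d)
  then show ?case by (metis pbw_sum_smul cong_smul)
next
  case (congruent p p')
  then show ?case by (meson cong_trans)
qed

section \<open>A faithful module on a quantum torus\<close>

lemma q_power_int_ne_1: "n \<noteq> 0 \<Longrightarrow> q powi n \<noteq> 1"
proof
  assume n: "n \<noteq> 0" and 1: "q powi n = 1"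
  have "q ^ nat \<bar>n\<bar> = 1"
    using 1 by (cases "n \<ge> 0") (auto simp: power_int_def power_inverse)
  with n q_not_root_of_unity[of "nat \<bar>n\<bar>"] show False by simp
qed

lemma q_sq_ne_1 [simp]: "q * q \<noteq> 1" "q\<^sup>2 \<noteq> 1"
  using q_power_int_ne_1[of 2] by (simp_all add: power2_eq_square)

lemma q_minus_inverse_nonzero [simp]: "q - inverse q \<noteq> 0"
  using q_sq_ne_1(1) by (metis eq_iff_diff_eq_0 q_nonzero right_inverse)

text \<open>
  Suppose that \<open>X, Y, Z\<close> act, that \<open>Z\<close> is invertible and that an operator \<open>W\<close> commutes with them. Then
  \<open>\<theta> = (W - q X - q\<^sup>-\<^sup>1 Y) Z\<^sup>-\<^sup>1 / (q - q\<^sup>-\<^sup>1)\<close> completes the action. In the relations of \<open>\<theta>\<close> with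
  \<open>X\<close> and \<open>Y\<close> the contributions of \<open>W\<close> cancel, and what is left is
  \<open>Y X - X Y = (q\<^sup>2 - q\<^sup>-\<^sup>2) Z\<^sup>2\<close>. Both modules of this
  development are of this kind, with different \<open>W\<close>; in each of them \<open>W\<close> is the action of the Casimir
  element.
\<close>

lemma relations_act_eq_0:
  fixes T :: "uq_gen \<Rightarrow> ('s \<Rightarrow> 'k) \<Rightarrow> ('s \<Rightarrow> 'k)" and W Zi :: "('s \<Rightarrow> 'k) \<Rightarrow> ('s \<Rightarrow> 'k)"
  assumes T: "\<And>g. linear_op (T g)" and W: "linear_op W" and Zi: "linear_op Zi"
    and W_T: "\<And>g f. g \<noteq> GTheta \<Longrightarrow> T g (W f) = W (T g f)"
    and Zi_Z: "\<And>f. Zi (T GZ f) = f" and Z_Zi: "\<And>f. T GZ (Zi f) = f"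
    and X_Z: "\<And>f. T GX (T GZ f) = (\<lambda>s. q\<^sup>2 * T GZ (T GX f) s)"
    and Z_Y: "\<And>f. T GZ (T GY f) = (\<lambda>s. q\<^sup>2 * T GY (T GZ f) s)"
    and X_Y: "\<And>f. T GX (T GY f) = (\<lambda>s. f s - q\<^sup>2 * T GZ (T GZ f) s)"
    and Y_X: "\<And>f. T GY (T GX f) = (\<lambda>s. f s - T GZ (T GZ f) s / q\<^sup>2)"
    and Theta: "\<And>f. T GTheta f =
      (\<lambda>s. (W (Zi f) s - q * T GX (Zi f) s - T GY (Zi f) s / q) / (q - inverse q))"
    and r: "r \<in> uq_relations q"
  shows "act T r f = (\<lambda>s. 0)"
proof
  fix s :: 's
  note linear = linear_op_simps[OF T] linear_op_simps[OF W] linear_op_simps[OF Zi]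
  have Zi_X: "Zi (T GX f) = (\<lambda>s. q\<^sup>2 * T GX (Zi f) s)" for f
  proof -
    have "T GX f = (\<lambda>s. q\<^sup>2 * T GZ (T GX (Zi f)) s)" using X_Z[of "Zi f"] by (simp add: Z_Zi)
    then have "Zi (T GX f) = (\<lambda>s. q\<^sup>2 * Zi (T GZ (T GX (Zi f))) s)"
      using Zi unfolding linear_op_def by metis
    then show ?thesis by (simp add: Zi_Z)
  qed
  have Zi_Y: "Zi (T GY f) = (\<lambda>s. T GY (Zi f) s / q\<^sup>2)" for f
  proof -
    have "T GY (Zi f) = Zi (T GZ (T GY (Zi f)))" by (simp add: Zi_Z)
    also have "\<dots> = (\<lambda>s. q\<^sup>2 * Zi (T GY f) s)" by (simp add: Z_Y Z_Zi linear fun_eq_iff)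
    finally show ?thesis by simp
  qed
  have Theta_X: "q * T GX (T GTheta f) s - inverse q * T GTheta (T GX f) s
      = (q + inverse q) * T GZ f s"
    by (simp add: Theta Zi_X linear W_T X_Y Y_X Z_Zi)
      (simp add: divide_simps, simp add: algebra_simps power2_eq_square)
  have Theta_Y: "q * T GTheta (T GY f) s - inverse q * T GY (T GTheta f) s
      = (q + inverse q) * T GZ f s"
    by (simp add: Theta Zi_Y linear W_T X_Y Y_X Z_Zi)
      (simp add: divide_simps, simp add: algebra_simps power2_eq_square)
  have Theta_Z: "T GTheta (T GZ f) s - T GZ (T GTheta f) s = T GY f s - T GX f s"
    using fun_cong[OF X_Z, of "Zi f" s] fun_cong[OF Z_Y, of "Zi f" s]
    by (simp add: Theta linear W_T Z_Zi Zi_Z)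
      (simp add: divide_simps, simp add: algebra_simps power2_eq_square)
  note act_simps =
    act_mult[where T = T, OF T] act_diff act_add act_smul act_free_gen act_one
  from r show "act T r f s = 0"
    unfolding relations_eq using Theta_X Theta_Y Theta_Z
    by (elim insertE emptyE; hypsubst)
      (simp_all add: act_simps X_Z Z_Y X_Y Y_X divide_inverse mult.commute)
qed

definition q2pow :: "int \<Rightarrow> 'k" where "q2pow l = q powi (2 * l)"

lemma q2pow_0 [simp]: "q2pow 0 = 1"
  by (simp add: q2pow_def)

lemma q2pow_nonzero [simp]: "q2pow l \<noteq> 0"
  by (simp add: q2pow_def)

lemma q2pow_shift:
  "q2pow (l + 1) = q\<^sup>2 * q2pow l" "q2pow (l - 1) = q2pow l / q\<^sup>2"
  "q2pow (l - 2) = q2pow l / q ^ 4" "q2pow (l + 2) = q ^ 4 * q2pow l"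
  by (simp_all add: q2pow_def power_int_add power_int_diff right_diff_distrib distrib_left)

lemma q2pow_eq_1_iff: "q2pow l = 1 \<longleftrightarrow> l = 0"
  using q_power_int_ne_1[of "2 * l"] by (auto simp: q2pow_def)

text \<open>
  Here \<open>f (l, k, m)\<close> is the coefficient of \<open>Z\<^sup>l X\<^sup>k \<Omega>\<^sup>m\<close>, with \<open>X Z = q\<^sup>2 Z X\<close> and \<open>\<Omega>\<close> central, and the
  generators act by left multiplication, with \<open>Y = X\<^sup>-\<^sup>1 (1 - q\<^sup>2 Z\<^sup>2)\<close> and
  \<open>\<theta> = (\<Omega> - q X - q\<^sup>-\<^sup>1 Y) Z\<^sup>-\<^sup>1 / (q - q\<^sup>-\<^sup>1)\<close>.
\<close>

fun torus_op :: "uq_gen \<Rightarrow> (int \<times> int \<times> int \<Rightarrow> 'k) \<Rightarrow> int \<times> int \<times> int \<Rightarrow> 'k"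
  where
    "torus_op GX f (l, k, m) = q2pow l * f (l, k - 1, m)"
  | "torus_op GY f (l, k, m) = (f (l, k + 1, m) - q\<^sup>2 * f (l - 2, k + 1, m)) / q2pow l"
  | "torus_op GZ f (l, k, m) = f (l - 1, k, m)"
  | "torus_op GTheta f (l, k, m) =
      (f (l + 1, k, m - 1) - q * q2pow l * f (l + 1, k - 1, m)
        - (f (l + 1, k + 1, m) - q\<^sup>2 * f (l - 1, k + 1, m)) / (q * q2pow l))
      / (q - inverse q)"

lemma linear_torus_op: "linear_op (torus_op g)"
  by (cases g)
    (auto simp: linear_op_def fun_eq_iff algebra_simps add_divide_distrib diff_divide_distrib)

lemmas torus_act_simps =
  act_mult[where T = torus_op, OF linear_torus_op] act_diff act_add act_smul act_free_gen act_one act_zero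

text \<open>
  Multiplication by \<open>\<Omega>\<close>.
\<close>

definition shift :: "(int \<times> int \<times> int \<Rightarrow> 'k) \<Rightarrow> int \<times> int \<times> int \<Rightarrow> 'k"
  where "shift f = (\<lambda>(l, k, m). f (l, k, m - 1))"

lemma linear_shift: "linear_op shift"
  by (auto simp: linear_op_def shift_def)

lemma torus_op_shift: "torus_op g (shift f) = shift (torus_op g f)"
  by (cases g) (auto simp: shift_def fun_eq_iff)

definition Z_inv :: "(int \<times> int \<times> int \<Rightarrow> 'k) \<Rightarrow> int \<times> int \<times> int \<Rightarrow> 'k"
  where "Z_inv f = (\<lambda>(l, k, m). f (l + 1, k, m))"

lemma torus_relations: "r \<in> uq_relations q \<Longrightarrow> act torus_op r f = (\<lambda>s. 0)"
proof (rule relations_act_eq_0[where T = torus_op and W = shift and Zi = Z_inv,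
      OF linear_torus_op linear_shift])
  show "linear_op Z_inv" by (auto simp: linear_op_def Z_inv_def)
  show "torus_op g (shift f) = shift (torus_op g f)" for g f by (rule torus_op_shift)
qed (auto simp: shift_def Z_inv_def q2pow_shift fun_eq_iff field_simps)

lemma act_torus_cong: "p \<cong>\<^sub>q p' \<Longrightarrow> act torus_op p f = act torus_op p' f"
  using act_uq_ideal[where T = torus_op and q = q and p = "p - p'" and f = f, OF linear_torus_op torus_relations]
  by (auto simp: cong_def act_diff fun_eq_iff)

definition torus_one :: "int \<times> int \<times> int \<Rightarrow> 'k"
  where "torus_one = (\<lambda>s. if s = (0, 0, 0) then 1 else 0)"

text \<open>
  The degrees in \<open>\<Omega>\<close> lie between \<open>0\<close> and \<open>m\<close>, and the part of degree \<open>m\<close> starts, in increasing powers of \<open>Z\<close>,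
  with a nonzero multiple of \<open>Z\<^sup>l X\<^sup>k\<close>. Each generator moves the leading term in a way that depends on
  the generator only: \<open>Y\<close> starts with \<open>X\<^sup>-\<^sup>1\<close>, and the part of \<open>\<theta>\<close> of highest degree in \<open>\<Omega>\<close> is a
  multiple of \<open>\<Omega> Z\<^sup>-\<^sup>1\<close>.
\<close>

definition leading_term :: "int \<Rightarrow> int \<Rightarrow> int \<Rightarrow> (int \<times> int \<times> int \<Rightarrow> 'k) \<Rightarrow> bool"
  where "leading_term l k m f \<longleftrightarrow>
    (\<forall>l' k' m'. m' < 0 \<or> m < m' \<longrightarrow> f (l', k', m') = 0) \<and>
    (\<forall>l' k'. l' < l \<longrightarrow> f (l', k', m) = 0) \<and>
    (\<exists>C. C \<noteq> 0 \<and> (\<forall>k'. f (l, k', m) = (if k' = k then C else 0)))"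

lemma leading_termI:
  assumes "\<And>l' k' m'. m' < 0 \<or> m < m' \<Longrightarrow> f (l', k', m') = 0"
    and "\<And>l' k'. l' < l \<Longrightarrow> f (l', k', m) = 0"
    and "C \<noteq> 0" and "\<And>k'. f (l, k', m) = (if k' = k then C else 0)"
  shows "leading_term l k m f"
  using assms unfolding leading_term_def by blast

lemma leading_torus_one: "leading_term 0 0 0 torus_one"
  by (rule leading_termI[where C = 1]) (auto simp: torus_one_def)

lemma leading_torus_op:
  assumes "leading_term l k m f"
  shows "leading_term l (k + 1) m (torus_op GX f)"
    and "leading_term l (k - 1) m (torus_op GY f)"
    and "leading_term (l + 1) k m (torus_op GZ f)"
    and "leading_term (l - 1) k (m + 1) (torus_op GTheta f)"
proof -
  from assms obtain C where C: "C \<noteq> 0" "\<And>k'. f (l, k', m) = (if k' = k then C else 0)"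
    and *: "\<And>l' k' m'. m' < 0 \<or> m < m' \<Longrightarrow> f (l', k', m') = 0" "\<And>l' k'. l' < l \<Longrightarrow> f (l', k', m) = 0"
    unfolding leading_term_def by blast
  show "leading_term l (k + 1) m (torus_op GX f)"
    by (rule leading_termI[where C = "q2pow l * C"]) (use C * in auto)
  show "leading_term l (k - 1) m (torus_op GY f)"
    by (rule leading_termI[where C = "C / q2pow l"]) (use C * in auto)
  show "leading_term (l + 1) k m (torus_op GZ f)"
    by (rule leading_termI[where C = C]) (use C * in auto)
  have "q \<noteq> inverse q" using q_minus_inverse_nonzero by simp
  show "leading_term (l - 1) k (m + 1) (torus_op GTheta f)"
    by (rule leading_termI[where C = "C / (q - inverse q)"]) (use C * \<open>q \<noteq> inverse q\<close> in auto)
qed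

lemma act_torus_power:
  "act torus_op (free_gen g ^ Suc n * p) f = torus_op g (act torus_op (free_gen g ^ n * p) f)"
  by (simp add: torus_act_simps mult.assoc)

lemma leading_xy_power: "leading_term 0 k 0 (act torus_op (xy_power k) torus_one)"
proof -
  have neg: "- int (Suc j) = - int j - 1" for j by simp
  have "leading_term 0 (int j) 0 (act torus_op (gX ^ j * 1) torus_one)" for j
  proof (induction j)
    case (Suc j)
    from leading_torus_op(1)[OF this] show ?case unfolding act_torus_power by (simp add: add.commute)
  qed (simp add: torus_act_simps leading_torus_one)
  moreover have "leading_term 0 (- int j) 0 (act torus_op (gY ^ j * 1) torus_one)" for j
  proof (induction j)
    case (Suc j)
    from leading_torus_op(2)[OF this] show ?case unfolding act_torus_power neg .
  qed (simp add: torus_act_simps leading_torus_one)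
  ultimately show ?thesis
    by (cases "k \<ge> 0") (auto simp: xy_power_def dest: meta_spec[of _ "nat k"] meta_spec[of _ "nat (- k)"])
qed

lemma leading_pbw_monomial:
  "leading_term (int a - int n) k (int n) (act torus_op (pbw_monomial (n, a, k)) torus_one)"
proof -
  have "leading_term (int a) k 0 (act torus_op (gZ ^ a * xy_power k) torus_one)"
  proof (induction a)
    case (Suc a)
    from leading_torus_op(3)[OF this] show ?case unfolding act_torus_power by (simp add: add.commute)
  qed (simp add: leading_xy_power)
  then have "leading_term (int a - int n) k (int n) (act torus_op (gTheta ^ n * (gZ ^ a * xy_power k)) torus_one)"
  proof (induction n)
    case (Suc n)
    from leading_torus_op(4)[OF Suc.IH[OF Suc.prems]] show ?case unfolding act_torus_power
      by (simp add: add.commute diff_diff_add)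
  qed simp
  then show ?thesis by (simp add: pbw_monomial_def)
qed

lemma act_pbw_sum:
  "act torus_op (pbw_sum c) f s =
    (\<Sum>t\<in>Poly_Mapping.keys c. Poly_Mapping.lookup c t * act torus_op (pbw_monomial t) f s)"
  by (simp add: pbw_sum_def act_sum act_smul)

text \<open>
  The position \<open>(a - n, k, n)\<close> of the leading term determines the monomial \<open>(n, a, k)\<close>. In a linear
  combination choose \<open>n\<close> maximal and then \<open>a\<close> minimal; at that position all other monomials have
  coefficient \<open>0\<close>, so nothing can cancel.
\<close>

lemma pbw_independent:
  assumes "act torus_op (pbw_sum c) torus_one = (\<lambda>s. 0)"
  shows "c = 0"
proof (rule ccontr)
  assume "c \<noteq> 0"
  let ?K = "Poly_Mapping.keys c"
  define n where "n = Max (fst ` ?K)"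
  have K: "finite (fst ` ?K)" "fst ` ?K \<noteq> {}" using \<open>c \<noteq> 0\<close> by auto
  define A where "A = {a. \<exists>k. (n, a, k) \<in> ?K}"
  define a where "a = Min A"
  have "A \<subseteq> (fst \<circ> snd) ` ?K" by (force simp: A_def)
  then have A: "finite A" by (rule finite_subset) simp
  have "n \<in> fst ` ?K" unfolding n_def using K by (rule Max_in)
  then have "A \<noteq> {}" by (force simp: A_def)
  with A have "a \<in> A" unfolding a_def by (rule Min_in)
  then obtain k where k: "(n, a, k) \<in> ?K" by (auto simp: A_def)
  let ?s = "(int a - int n, k, int n)"
  obtain C where C: "C \<noteq> 0" "act torus_op (pbw_monomial (n, a, k)) torus_one ?s = C"
    using leading_pbw_monomial[of a n k] by (auto simp: leading_term_def)
  have other: "act torus_op (pbw_monomial t) torus_one ?s = 0" if t: "t \<in> ?K" "t \<noteq> (n, a, k)" for t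
  proof -
    obtain n' a' k' where t': "t = (n', a', k')" by (cases t)
    have "n' \<le> n" unfolding n_def using t K by (intro Max_ge) (force simp: t')+
    have "a \<le> a'" if "n' = n"
      unfolding a_def using t that A by (intro Min_le) (auto simp: A_def t')
    with leading_pbw_monomial[of a' n' k'] \<open>n' \<le> n\<close> t(2) show ?thesis
      unfolding t' leading_term_def by (cases "n' = n"; cases "a' = a") auto
  qed
  have "act torus_op (pbw_sum c) torus_one ?s = Poly_Mapping.lookup c (n, a, k) * C"
    unfolding act_pbw_sum using other k C(2) by (subst sum.remove[OF _ k]) auto
  with assms C(1) k show False by (auto simp: in_keys_iff)
qed

text \<open>
  Equality in the quotient of the free algebra can therefore be tested on a single vector. Together
  with the spanning property this is the whole of the Poincare-Birkhoff-Witt theorem that is needed.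
\<close>

lemma cong_iff_act_torus_one:
  "p \<cong>\<^sub>q p' \<longleftrightarrow> act torus_op p torus_one = act torus_op p' torus_one"
proof
  assume eq: "act torus_op p torus_one = act torus_op p' torus_one"
  obtain c where c: "p - p' \<cong>\<^sub>q pbw_sum c" using ex_pbw_sum by blast
  from act_torus_cong[OF this, of torus_one] eq have "act torus_op (pbw_sum c) torus_one = (\<lambda>s. 0)"
    by (simp add: act_diff)
  then have "c = 0" by (rule pbw_independent)
  with c show "p \<cong>\<^sub>q p'" by (simp add: pbw_sum_def cong_def)
qed (rule act_torus_cong)

section \<open>The centre\<close>

definition Casimir :: "uq_gen word \<Rightarrow>\<^sub>0 'k"
  where "Casimir = smul q gX + smul (inverse q) gY + smul (q - inverse q) (gTheta * gZ)"

lemma act_Casimir: "act torus_op Casimir f = shift f"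
proof (rule ext)
  fix s :: "int \<times> int \<times> int"
  obtain l k m where s: "s = (l, k, m)" by (cases s)
  show "act torus_op Casimir f s = shift f s"
    unfolding s Casimir_def shift_def torus_act_simps torus_op.simps prod.case
      times_divide_eq_right nonzero_mult_div_cancel_left[OF q_minus_inverse_nonzero]
    by (simp add: divide_simps) (simp add: algebra_simps)
qed

lemma act_shift: "act torus_op p (shift f) = shift (act torus_op p f)"
  by (rule act_commute[where R = shift and T = torus_op, OF linear_shift torus_op_shift])

text \<open>
  By faithfulness it is enough that the shift commutes with all operators of the module.
\<close>

lemma Casimir_central: "Casimir * p \<cong>\<^sub>q p * Casimir"
  unfolding cong_iff_act_torus_one by (simp add: torus_act_simps act_Casimir act_shift)

lemma act_Casimir_power:
  "act torus_op (Casimir ^ n) torus_one (l, k, m) = (if l = 0 \<and> k = 0 \<and> m = int n then 1 else 0)"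
proof (induction n arbitrary: m)
  case 0
  show ?case by (simp add: act_one torus_one_def)
next
  case (Suc n)
  then show ?case by (auto simp: torus_act_simps act_Casimir shift_def)
qed

lemma act_poly_at_Casimir:
  "act torus_op (poly_at Casimir N d) torus_one (l, k, m) =
    (if l = 0 \<and> k = 0 \<and> 0 \<le> m \<and> m < int N then d (nat m) else 0)"
proof -
  have "act torus_op (poly_at Casimir N d) torus_one (l, k, m)
      = (\<Sum>n<N. if n = nat m \<and> l = 0 \<and> k = 0 \<and> 0 \<le> m then d n else 0)"
    unfolding poly_at_def act_sum act_smul act_Casimir_power by (rule sum.cong) auto
  also have "\<dots> = (if l = 0 \<and> k = 0 \<and> 0 \<le> m \<and> m < int N then d (nat m) else 0)"
    by (cases "l = 0 \<and> k = 0 \<and> 0 \<le> m") (auto simp: sum.delta' nat_less_iff)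
  finally show ?thesis .
qed

text \<open>
  Right multiplications on the torus; the factor comes from \<open>X\<^sup>k Z = q\<^bsup>2k\<^esup> Z X\<^sup>k\<close>.
\<close>

definition right_X :: "(int \<times> int \<times> int \<Rightarrow> 'k) \<Rightarrow> int \<times> int \<times> int \<Rightarrow> 'k"
  where "right_X f = (\<lambda>(l, k, m). f (l, k - 1, m))"

definition right_Z :: "(int \<times> int \<times> int \<Rightarrow> 'k) \<Rightarrow> int \<times> int \<times> int \<Rightarrow> 'k"
  where "right_Z f = (\<lambda>(l, k, m). q2pow k * f (l - 1, k, m))"

lemma act_right_X: "act torus_op p (right_X f) = right_X (act torus_op p f)"
proof (rule act_commute)
  show "linear_op right_X" by (auto simp: linear_op_def right_X_def)
  show "torus_op g (right_X f) = right_X (torus_op g f)" for g f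
    by (cases g) (auto simp: right_X_def fun_eq_iff add.commute add_diff_eq)
qed

lemma act_right_Z: "act torus_op p (right_Z f) = right_Z (act torus_op p f)"
proof (rule act_commute)
  show "linear_op right_Z" by (auto simp: linear_op_def right_Z_def algebra_simps)
  show "torus_op g (right_Z f) = right_Z (torus_op g f)" for g f
    by (cases g) (auto simp: right_Z_def fun_eq_iff q2pow_shift divide_simps, auto simp: algebra_simps power2_eq_square)
qed

text \<open>
  Let \<open>v\<close> be the vector \<open>z \<cdot> 1\<close>. Since \<open>z\<close> commutes with \<open>X\<close> and \<open>Z\<close>, multiplying \<open>v\<close> by \<open>X\<close>
  from the left or from the right gives the same result, and likewise for \<open>Z\<close>. On \<open>Z\<^sup>l X\<^sup>k\<close> the two sides
  differ by the factors \<open>q\<^bsup>2l\<^esup>\<close> and \<open>q\<^bsup>2k\<^esup>\<close>, which are different from \<open>1\<close> unless \<open>l = k = 0\<close>. So \<open>v\<close> involves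
  only powers of \<open>\<Omega>\<close>, finitely many of them because \<open>z\<close> is a finite sum of ordered monomials.
\<close>

lemma central_in_Casimir:
  assumes "z * gX \<cong>\<^sub>q gX * z" and "z * gZ \<cong>\<^sub>q gZ * z"
  shows "\<exists>N d. z \<cong>\<^sub>q poly_at Casimir N d"
proof -
  let ?v = "act torus_op z torus_one"
  have "torus_op GX torus_one = right_X torus_one"
    by (auto simp: right_X_def torus_one_def fun_eq_iff)
  with act_torus_cong[OF assms(1), of torus_one] have X: "right_X ?v = torus_op GX ?v"
    by (simp add: torus_act_simps act_right_X)
  have "torus_op GZ torus_one = right_Z torus_one"
    by (auto simp: right_Z_def torus_one_def fun_eq_iff)
  with act_torus_cong[OF assms(2), of torus_one] have Z: "right_Z ?v = torus_op GZ ?v"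
    by (simp add: torus_act_simps act_right_Z)
  have v0: "?v (l, k, m) = 0" if "l \<noteq> 0 \<or> k \<noteq> 0" for l k m
  proof (cases "l = 0")
    case False
    from fun_cong[OF X, of "(l, k + 1, m)"] False show ?thesis
      by (auto simp: right_X_def q2pow_eq_1_iff)
  next
    case True
    from fun_cong[OF Z, of "(l + 1, k, m)"] True that show ?thesis
      by (auto simp: right_Z_def q2pow_eq_1_iff)
  qed
  obtain c where "z \<cong>\<^sub>q pbw_sum c" using ex_pbw_sum by blast
  from act_torus_cong[OF this, of torus_one]
  have v: "?v s = (\<Sum>t\<in>Poly_Mapping.keys c. Poly_Mapping.lookup c t * act torus_op (pbw_monomial t) torus_one s)" for s
    by (simp add: act_pbw_sum)
  define N where "N = Suc (Max (fst ` Poly_Mapping.keys c))"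
  have N: "?v (l, k, m) = 0" if m: "m < 0 \<or> m \<ge> int N" for l k m
    unfolding v
  proof (rule sum.neutral, rule ballI)
    fix t assume t: "t \<in> Poly_Mapping.keys c"
    obtain n a k' where t': "t = (n, a, k')" by (cases t)
    have "n \<le> Max (fst ` Poly_Mapping.keys c)"
      using t by (intro Max_ge) (force simp: t')+
    then have "act torus_op (pbw_monomial t) torus_one (l, k, m) = 0"
      using leading_pbw_monomial[of a n k'] m unfolding t' leading_term_def N_def by auto
    then show "Poly_Mapping.lookup c t * act torus_op (pbw_monomial t) torus_one (l, k, m) = 0" by simp
  qed
  have "z \<cong>\<^sub>q poly_at Casimir N (\<lambda>m. ?v (0, 0, int m))"
    unfolding cong_iff_act_torus_one
  proof (rule ext)
    fix s :: "int \<times> int \<times> int"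
    obtain l k m where s: "s = (l, k, m)" by (cases s)
    show "?v s = act torus_op (poly_at Casimir N (\<lambda>m. ?v (0, 0, int m))) torus_one s"
      unfolding s act_poly_at_Casimir using v0 N by auto
  qed
  then show ?thesis by blast
qed

end

section \<open>The right module that defines \<open>\<gamma>\<close>\<close>

lemma lookup_mult_single_1:
  fixes p :: "int \<Rightarrow>\<^sub>0 'k::field"
  shows "Poly_Mapping.lookup (p * Poly_Mapping.single a 1) k = Poly_Mapping.lookup p (k - a)"
  by (induction p rule: poly_mapping_add_induct)
    (auto simp: mult_single lookup_single lookup_add distrib_right when_def)

context uq begin

text \<open>
  The algebra acts from the right on the torus with basis \<open>X\<^sup>k Z\<^sup>l\<close> as follows: \<open>X, Y, Z\<close> by right
  multiplication, and \<open>\<Omega>\<close> by left multiplication with \<open>q X + q\<^sup>-\<^sup>1 Y\<close>. This choice is made so that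
  \<open>1 \<cdot> \<theta> = 0\<close>. To stay with left modules, the generators are made to act on functionals:
  \<open>f (k, l)\<close> is the value of \<open>f\<close> at \<open>X\<^sup>k Z\<^sup>l\<close>, and \<open>(g f)(v) = f (v \<cdot> g)\<close>.
\<close>

fun dual_op :: "uq_gen \<Rightarrow> (int \<times> int \<Rightarrow> 'k) \<Rightarrow> int \<times> int \<Rightarrow> 'k"
  where
    "dual_op GX f (k, l) = f (k + 1, l) / q2pow l"
  | "dual_op GY f (k, l) = q2pow l * (f (k - 1, l) - q\<^sup>2 * f (k - 1, l + 2))"
  | "dual_op GZ f (k, l) = f (k, l + 1)"
  | "dual_op GTheta f (k, l) =
      (q * (1 - 1 / q2pow l) * f (k + 1, l - 1) + (1 - q2pow l) / q * f (k - 1, l - 1)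
        + q * (q2pow l - 1 / q2pow k ^ 2) * f (k - 1, l + 1)) / (q - inverse q)"

lemma linear_dual_op: "linear_op (dual_op g)"
  by (cases g) (auto simp: linear_op_def fun_eq_iff algebra_simps add_divide_distrib diff_divide_distrib)

lemma dual_relations: "r \<in> uq_relations q \<Longrightarrow> act dual_op r f = (\<lambda>s. 0)"
proof (rule relations_act_eq_0[where T = dual_op and Zi = "\<lambda>f (k, l). f (k, l - 1)"
      and W = "\<lambda>f (k, l). q * f (k + 1, l) + f (k - 1, l) / q - q / q2pow k ^ 2 * f (k - 1, l + 2)",
      OF linear_dual_op])
  let ?W = "\<lambda>f (k, l). q * f (k + 1, l) + f (k - 1, l) / q - q / q2pow k ^ 2 * f (k - 1, l + 2)"
  \<comment> \<open>\<open>?W\<close> is dual to left multiplication with \<open>q X + q\<^sup>-\<^sup>1 Y\<close>.\<close>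
  show "linear_op ?W"
    by (auto simp: linear_op_def fun_eq_iff algebra_simps add_divide_distrib diff_divide_distrib)
  show "dual_op g (?W f) = ?W (dual_op g f)" if "g \<noteq> GTheta" for g f
    using that
    by (cases g) (auto simp: fun_eq_iff q2pow_shift divide_simps, auto simp: algebra_simps power2_eq_square power_numeral_even)
qed (auto simp: linear_op_def q2pow_shift fun_eq_iff divide_simps, auto simp: algebra_simps power2_eq_square power_numeral_even)

lemma act_dual_cong: "p \<cong>\<^sub>q p' \<Longrightarrow> act dual_op p f = act dual_op p' f"
  using act_uq_ideal[where T = dual_op and q = q and p = "p - p'" and f = f, OF linear_dual_op dual_relations]
  by (auto simp: cong_def act_diff fun_eq_iff)

text \<open>
  The functional that reads off the coefficient of \<open>X\<^sup>k Z\<^sup>0\<close>.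
\<close>

definition coeff_X :: "int \<Rightarrow> int \<times> int \<Rightarrow> 'k"
  where "coeff_X k = (\<lambda>s. if s = (k, 0) then 1 else 0)"

lemma finite_foldr_dual: "finite {k. foldr dual_op gs (coeff_X k) s \<noteq> 0}"
proof (induction gs arbitrary: s)
  case Nil
  have "{k. coeff_X k s \<noteq> 0} \<subseteq> {fst s}" by (auto simp: coeff_X_def)
  then show ?case by (simp add: finite_subset)
next
  case (Cons g gs)
  obtain k0 l0 where s: "s = (k0, l0)" by (cases s)
  let ?F = "\<lambda>s. {k. foldr dual_op gs (coeff_X k) s \<noteq> 0}"
  have "{k. foldr dual_op (g # gs) (coeff_X k) s \<noteq> 0} \<subseteq>
    (\<Union>s' \<in> {(k0 + 1, l0), (k0 - 1, l0), (k0 - 1, l0 + 2), (k0, l0 + 1),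
      (k0 + 1, l0 - 1), (k0 - 1, l0 - 1), (k0 - 1, l0 + 1)}. ?F s')"
    unfolding s by (cases g) auto
  then show ?case by (rule finite_subset) (simp add: Cons)
qed

lemma finite_act_dual: "finite {k. act dual_op p (coeff_X k) s \<noteq> 0}"
proof -
  have "{k. act dual_op p (coeff_X k) s \<noteq> 0} \<subseteq>
    (\<Union>w\<in>Poly_Mapping.keys p. {k. foldr dual_op (letters w) (coeff_X k) s \<noteq> 0})"
    unfolding act_def using sum.not_neutral_contains_not_neutral by fastforce
  then show ?thesis by (rule finite_subset) (simp add: finite_foldr_dual)
qed

text \<open>
  The part without \<open>Z\<close> of the vector \<open>1 \<cdot> p\<close>, with \<open>X\<close> renamed to \<open>t\<close>.
\<close>

definition gamma_hat :: "(uq_gen word \<Rightarrow>\<^sub>0 'k) \<Rightarrow> (int \<Rightarrow>\<^sub>0 'k)"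
  where "gamma_hat p = Abs_poly_mapping (\<lambda>k. act dual_op p (coeff_X k) (0, 0))"

lemma lookup_gamma_hat: "Poly_Mapping.lookup (gamma_hat p) k = act dual_op p (coeff_X k) (0, 0)"
  unfolding gamma_hat_def by (simp add: finite_act_dual)

lemma gamma_hat_cong: "p \<cong>\<^sub>q p' \<Longrightarrow> gamma_hat p = gamma_hat p'"
  by (simp add: gamma_hat_def act_dual_cong)

lemma gamma_hat_add: "gamma_hat (p + p') = gamma_hat p + gamma_hat p'"
  by (rule poly_mapping_eqI) (simp add: lookup_gamma_hat lookup_add act_add)

lemma gamma_hat_smul: "gamma_hat (smul c p) = smul c (gamma_hat p)"
  by (rule poly_mapping_eqI) (simp add: lookup_gamma_hat act_smul)

lemma gamma_hat_0: "gamma_hat 0 = 0"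
  by (rule poly_mapping_eqI) (simp add: lookup_gamma_hat act_zero)

lemma gamma_hat_1: "gamma_hat 1 = 1"
  by (rule poly_mapping_eqI) (simp add: lookup_gamma_hat act_one coeff_X_def lookup_one when_def)

text \<open>
  This expresses \<open>1 \<cdot> \<theta> = 0\<close>: at the index \<open>(0, 0)\<close> all three coefficients in the formula for
  \<open>\<theta>\<close> vanish.
\<close>

lemma gamma_hat_Theta: "gamma_hat (gTheta * p) = 0"
  by (rule poly_mapping_eqI)
    (simp add: lookup_gamma_hat act_mult[where T = dual_op, OF linear_dual_op] act_free_gen)

text \<open>
  The vectors \<open>X\<^sup>k Z\<^sup>l\<close> with \<open>l \<ge> 0\<close> span a submodule: at \<open>l = 0\<close> the coefficients of the terms in
  \<open>Z\<^sup>l\<^sup>-\<^sup>1\<close> of \<open>X\<^sup>k Z\<^sup>l \<cdot> \<theta>\<close> are \<open>0\<close>. It contains \<open>1\<close>, so functionals that vanish on it can be neglected.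
\<close>

lemma act_dual_vanish:
  assumes "\<And>k l. l \<ge> 0 \<Longrightarrow> f (k, l) = 0" and "l \<ge> 0"
  shows "act dual_op p f (k, l) = 0"
proof -
  have "foldr dual_op gs f (k, l) = 0" if "l \<ge> 0" for gs k l
    using that
  proof (induction gs arbitrary: k l)
    case (Cons g gs)
    then show ?case
      by (cases g; cases "l = 0") auto
  qed (simp add: assms(1))
  then show ?thesis by (simp add: act_def assms(2))
qed

lemma gamma_hat_X: "gamma_hat (p * gX) = gamma_hat p * laurent_t"
proof (rule poly_mapping_eqI)
  fix k
  have "dual_op GX (coeff_X k) = coeff_X (k - 1)" by (auto simp: coeff_X_def fun_eq_iff)
  then show "Poly_Mapping.lookup (gamma_hat (p * gX)) k = Poly_Mapping.lookup (gamma_hat p * laurent_t) k"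
    by (simp add: lookup_gamma_hat act_mult[where T = dual_op, OF linear_dual_op] act_free_gen
      laurent_t_def lookup_mult_single_1)
qed

lemma gamma_hat_Z: "gamma_hat (p * gZ) = 0"
proof (rule poly_mapping_eqI)
  fix k
  \<comment> \<open>The functional is supported at \<open>l = -1\<close>.\<close>
  have "act dual_op p (dual_op GZ (coeff_X k)) (0, 0) = 0"
    by (rule act_dual_vanish) (auto simp: coeff_X_def)
  then show "Poly_Mapping.lookup (gamma_hat (p * gZ)) k = Poly_Mapping.lookup 0 k"
    by (simp add: lookup_gamma_hat act_mult[where T = dual_op, OF linear_dual_op] act_free_gen)
qed

lemma gamma_hat_Y: "gamma_hat (p * gY) = gamma_hat p * laurent_t_inv"
proof (rule poly_mapping_eqI)
  fix k
  let ?h = "\<lambda>s. dual_op GY (coeff_X k) s - coeff_X (k + 1) s"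
  \<comment> \<open>The difference \<open>?h\<close> is supported at \<open>l = -2\<close>.\<close>
  have "act dual_op p ?h (0, 0) = 0"
    by (rule act_dual_vanish) (auto simp: coeff_X_def)
  moreover have "act dual_op p ?h (0, 0) =
      act dual_op p (dual_op GY (coeff_X k)) (0, 0) - act dual_op p (coeff_X (k + 1)) (0, 0)"
    by (simp only: linear_op_simps[OF linear_op_act[OF linear_dual_op]])
  ultimately show "Poly_Mapping.lookup (gamma_hat (p * gY)) k =
      Poly_Mapping.lookup (gamma_hat p * laurent_t_inv) k"
    by (simp add: lookup_gamma_hat act_mult[where T = dual_op, OF linear_dual_op] act_free_gen
      laurent_t_inv_def lookup_mult_single_1)
qed

text \<open>
  Representatives of the subalgebra generated by a set of generators.
\<close>

definition letters_in :: "uq_gen set \<Rightarrow> (uq_gen word \<Rightarrow>\<^sub>0 'k) set"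
  where "letters_in A = {p. \<forall>w\<in>Poly_Mapping.keys p. set (letters w) \<subseteq> A}"

lemma letters_in_induct [consumes 1, case_names one mult_gen add scale]:
  assumes "p \<in> letters_in A"
    and "P 1"
    and "\<And>g p. g \<in> A \<Longrightarrow> P p \<Longrightarrow> P (free_gen g * p)"
    and "\<And>p p'. P p \<Longrightarrow> P p' \<Longrightarrow> P (p + p')"
    and "\<And>c p. P p \<Longrightarrow> P (smul c p)"
  shows "P p"
proof -
  have P_0: "P 0" using assms(5)[OF assms(2), of 0] by simp
  have word: "P (Poly_Mapping.single (Word gs) 1)" if "set gs \<subseteq> A" for gs
    using that
  proof (induction gs)
    case Nil
    then show ?case using assms(2) by (simp add: zero_word_def flip: single_one)
  next
    case (Cons g gs)
    then show ?case using assms(3) by (simp add: single_Word_Cons)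
  qed
  have p: "p = (\<Sum>w\<in>Poly_Mapping.keys p. smul (Poly_Mapping.lookup p w) (Poly_Mapping.single w 1))"
    by (rule poly_mapping_eqI)
      (simp add: smul_single lookup_sum lookup_single when_def in_keys_iff)
  have "P (\<Sum>w\<in>S. smul (Poly_Mapping.lookup p w) (Poly_Mapping.single w 1))"
    if "S \<subseteq> Poly_Mapping.keys p" for S
    using finite_subset[OF that finite_keys] that
  proof (induction S rule: finite_induct)
    case (insert w S)
    then have "P (Poly_Mapping.single w 1)"
      using word[of "letters w"] assms(1) by (auto simp: letters_in_def)
    with insert show ?case using assms(4,5) by auto
  qed (simp add: P_0)
  then show ?thesis by (subst p) simp
qed

text \<open>
  For a generator \<open>y\<close> the claim is one of the three preceding lemmas.
\<close>

lemma gamma_hat_mult: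
  assumes "y \<in> letters_in {GX, GY, GZ}"
  shows "gamma_hat (p * y) = gamma_hat p * gamma_hat y"
  using assms
proof (induction arbitrary: p rule: letters_in_induct)
  case one
  show ?case by (simp add: gamma_hat_1)
next
  case (mult_gen g y)
  have gen: "gamma_hat (r * free_gen g) = gamma_hat r * gamma_hat (free_gen g)" for r
    using mult_gen(1) gamma_hat_X[of r] gamma_hat_X[of 1] gamma_hat_Y[of r] gamma_hat_Y[of 1]
      gamma_hat_Z[of r] gamma_hat_Z[of 1] by (auto simp: gamma_hat_1)
  show ?case
    using mult_gen(2)[of "p * free_gen g"] mult_gen(2)[of "free_gen g"] gen by (simp add: mult.assoc)
next
  case (add p p')
  then show ?case by (simp add: distrib_left gamma_hat_add)
next
  case (scale c p)
  then show ?case by (simp add: gamma_hat_smul)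
qed

text \<open>
  Only the constant term of the polynomial \<open>x\<close> in \<open>\<theta>\<close> survives.
\<close>

lemma gamma_hat_letters_Theta:
  assumes "x \<in> letters_in {GTheta}"
  shows "gamma_hat (x * p) = smul (Poly_Mapping.lookup (gamma_hat x) 0) (gamma_hat p)"
  using assms
proof (induction rule: letters_in_induct)
  case (mult_gen g y)
  then show ?case by (simp add: mult.assoc gamma_hat_Theta)
qed (simp_all add: gamma_hat_0 gamma_hat_1 gamma_hat_add gamma_hat_smul distrib_right lookup_add smul_distribs)

end

section \<open>Laurent polynomials\<close>

lemma laurent_algebra_simps:
  "carrier laurent_algebra = UNIV"
  "x \<otimes>\<^bsub>laurent_algebra\<^esub> y = x * y"
  "x \<oplus>\<^bsub>laurent_algebra\<^esub> y = x + y"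
  "\<one>\<^bsub>laurent_algebra\<^esub> = 1"
  "c \<odot>\<^bsub>laurent_algebra\<^esub> x = smul c x"
  by (simp_all add: laurent_algebra_def algebra_of_type_def ring.defs module.defs
        ring_of_type_algebra_def smul_def)

text \<open>
  The value at \<open>t\<close> determines the value at \<open>t\<^sup>-\<^sup>1\<close>, because inverses in a commutative ring are unique.
\<close>

lemma algebra_hom_laurent_unique:
  assumes h: "h \<in> algebra_hom laurent_algebra laurent_algebra"
    and h': "h' \<in> algebra_hom laurent_algebra laurent_algebra"
    and eq: "h laurent_t = h' (laurent_t :: int \<Rightarrow>\<^sub>0 'k::field)"
  shows "h = h'"
proof
  fix p :: "int \<Rightarrow>\<^sub>0 'k"
  have hom: "f (x + y) = f x + f y" "f (x * y) = f x * f y" "f 1 = 1" "f (smul c x) = smul c (f x)"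
    if "f \<in> algebra_hom laurent_algebra laurent_algebra"
    for f :: "(int \<Rightarrow>\<^sub>0 'k) \<Rightarrow> (int \<Rightarrow>\<^sub>0 'k)" and x y c
    using that by (auto simp: algebra_hom_def linear_maps_def ring_hom_def laurent_algebra_simps)
  have t: "laurent_t * laurent_t_inv = (1 :: int \<Rightarrow>\<^sub>0 'k)"
    by (simp add: laurent_t_def laurent_t_inv_def mult_single)
  have "h laurent_t_inv = h laurent_t_inv * h' (laurent_t * laurent_t_inv)"
    unfolding t by (simp add: hom[OF h'])
  also have "\<dots> = h (laurent_t * laurent_t_inv) * h' laurent_t_inv"
    by (simp add: hom[OF h] hom[OF h'] eq mult_ac)
  also have "\<dots> = h' laurent_t_inv"
    unfolding t by (simp add: hom[OF h])
  finally have eq': "h laurent_t_inv = h' laurent_t_inv" .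
  have pos: "h (Poly_Mapping.single (int n) 1) = h' (Poly_Mapping.single (int n) 1)" for n
  proof (induction n)
    case (Suc n)
    have "Poly_Mapping.single (int (Suc n)) 1 = (laurent_t * Poly_Mapping.single (int n) 1 :: int \<Rightarrow>\<^sub>0 'k)"
      by (simp add: laurent_t_def mult_single)
    with Suc show ?case by (simp only: hom[OF h] hom[OF h'] eq)
  qed (simp add: hom[OF h] hom[OF h'])
  have neg: "h (Poly_Mapping.single (- int n) 1) = h' (Poly_Mapping.single (- int n) 1)" for n
  proof (induction n)
    case (Suc n)
    have "Poly_Mapping.single (- int (Suc n)) 1 =
        (laurent_t_inv * Poly_Mapping.single (- int n) 1 :: int \<Rightarrow>\<^sub>0 'k)"
      by (simp add: laurent_t_inv_def mult_single)
    with Suc show ?case by (simp only: hom[OF h] hom[OF h'] eq')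
  qed (simp add: hom[OF h] hom[OF h'])
  have single: "h (Poly_Mapping.single k c) = h' (Poly_Mapping.single k c)" for k c
  proof -
    have "h (Poly_Mapping.single k 1) = h' (Poly_Mapping.single k 1)"
      using pos[of "nat k"] neg[of "nat (- k)"] by (cases "k \<ge> 0") auto
    then have "h (smul c (Poly_Mapping.single k 1)) = h' (smul c (Poly_Mapping.single k 1))"
      by (simp only: hom[OF h] hom[OF h'])
    then show ?thesis by (simp add: smul_single)
  qed
  show "h p = h' p"
  proof (induction p rule: poly_mapping_add_induct)
    case zero
    show ?case using single[of 0 0] by simp
  qed (simp_all add: single hom[OF h] hom[OF h'])
qed

lemma laurent_automorphism_eqI:
  fixes f :: "(int \<Rightarrow>\<^sub>0 'k::field) \<Rightarrow> (int \<Rightarrow>\<^sub>0 'k)"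
  assumes "\<And>x y. f (x + y) = f x + f y" "\<And>x y. f (x * y) = f x * f y" "f 1 = 1"
    and "\<And>c x. f (smul c x) = smul c (f x)" and "bij f"
  shows "laurent_automorphism (f laurent_t) = f"
  unfolding laurent_automorphism_def
proof (rule the_equality)
  have f: "f \<in> algebra_iso laurent_algebra laurent_algebra"
    using assms
    by (auto simp: algebra_iso_def algebra_hom_def linear_maps_def ring_hom_def laurent_algebra_simps)
  then show "f \<in> algebra_iso laurent_algebra laurent_algebra \<and> f laurent_t = f laurent_t" by simp
  show "g = f" if "g \<in> algebra_iso laurent_algebra laurent_algebra \<and> g laurent_t = f laurent_t" for g
    using that f by (intro algebra_hom_laurent_unique) (auto simp: algebra_iso_def)
qed

definition laurent_scale :: "'k::field \<Rightarrow> (int \<Rightarrow>\<^sub>0 'k) \<Rightarrow> (int \<Rightarrow>\<^sub>0 'k)"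
  where "laurent_scale a = Poly_Mapping.mapp (\<lambda>k c. a powi k * c)"

lemma lookup_laurent_scale:
  "Poly_Mapping.lookup (laurent_scale a p) k = a powi k * Poly_Mapping.lookup p k"
  by (auto simp: laurent_scale_def lookup_mapp when_def in_keys_iff)

lemma laurent_scale_add: "laurent_scale a (p + p') = laurent_scale a p + laurent_scale a p'"
  by (rule poly_mapping_eqI) (simp add: lookup_laurent_scale lookup_add distrib_left)

lemma laurent_scale_smul: "laurent_scale a (smul c p) = smul c (laurent_scale a p)"
  by (rule poly_mapping_eqI) (simp add: lookup_laurent_scale)

lemma laurent_scale_single:
  "laurent_scale a (Poly_Mapping.single k c) = Poly_Mapping.single k (a powi k * c)"
  by (rule poly_mapping_eqI) (auto simp: lookup_laurent_scale lookup_single when_def)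

lemma laurent_scale_1: "laurent_scale a 1 = 1"
  using laurent_scale_single[of a 0 1] by simp

lemma laurent_scale_0: "laurent_scale a 0 = 0"
  using laurent_scale_single[of a 0 0] by simp

lemma laurent_scale_mult:
  assumes "a \<noteq> 0"
  shows "laurent_scale a (p * p') = laurent_scale a p * laurent_scale a p'"
proof (induction p rule: poly_mapping_add_induct)
  case (single k c)
  show ?case
    by (induction p' rule: poly_mapping_add_induct)
      (use assms in \<open>simp_all add: laurent_scale_0 laurent_scale_add distrib_left mult_single
        laurent_scale_single power_int_add mult.left_commute mult.assoc\<close>)
qed (simp_all add: laurent_scale_0 laurent_scale_add distrib_right)

lemma laurent_scale_inverse:
  "a \<noteq> 0 \<Longrightarrow> laurent_scale (inverse a) (laurent_scale a p) = p"
  by (rule poly_mapping_eqI) (simp add: lookup_laurent_scale power_int_inverse)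

lemma sigma_map_eq: "q \<noteq> 0 \<Longrightarrow> sigma_map q = laurent_scale (inverse q)"
proof -
  assume q: "q \<noteq> 0"
  have "bij (laurent_scale (inverse q))"
    using laurent_scale_inverse[of q] laurent_scale_inverse[of "inverse q"] q
    by (intro o_bij[of "laurent_scale q"]) (auto simp: fun_eq_iff)
  then have "laurent_automorphism (laurent_scale (inverse q) laurent_t) = laurent_scale (inverse q)"
    using q by (intro laurent_automorphism_eqI)
      (simp_all add: laurent_scale_add laurent_scale_mult laurent_scale_1 laurent_scale_smul)
  then show ?thesis
    by (simp add: sigma_map_def laurent_t_def laurent_scale_single mult_single)
qed

definition laurent_flip :: "(int \<Rightarrow>\<^sub>0 'k::field) \<Rightarrow> (int \<Rightarrow>\<^sub>0 'k)"
  where "laurent_flip = Poly_Mapping.map_key uminus"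

lemma lookup_laurent_flip: "Poly_Mapping.lookup (laurent_flip p) k = Poly_Mapping.lookup p (- k)"
  by (simp add: laurent_flip_def map_key.rep_eq)

lemma laurent_flip_add: "laurent_flip (p + p') = laurent_flip p + laurent_flip p'"
  by (rule poly_mapping_eqI) (simp add: lookup_laurent_flip lookup_add)

lemma laurent_flip_smul: "laurent_flip (smul c p) = smul c (laurent_flip p)"
  by (rule poly_mapping_eqI) (simp add: lookup_laurent_flip)

lemma laurent_flip_single:
  "laurent_flip (Poly_Mapping.single k c) = Poly_Mapping.single (- k) c"
  by (rule poly_mapping_eqI) (auto simp: lookup_laurent_flip lookup_single when_def)

lemma laurent_flip_0: "laurent_flip 0 = 0"
  using laurent_flip_single[of 0 0] by simp

lemma laurent_flip_mult: "laurent_flip (p * p') = laurent_flip p * laurent_flip p'"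
proof (induction p rule: poly_mapping_add_induct)
  case (single k c)
  show ?case
    by (induction p' rule: poly_mapping_add_induct)
      (simp_all add: laurent_flip_0 laurent_flip_add distrib_left mult_single laurent_flip_single)
qed (simp_all add: laurent_flip_0 laurent_flip_add distrib_right)

lemma laurent_automorphism_t_inv:
  "laurent_automorphism (laurent_t_inv :: int \<Rightarrow>\<^sub>0 'k::field) = laurent_flip"
proof -
  have flip_flip: "laurent_flip (laurent_flip p) = p" for p :: "int \<Rightarrow>\<^sub>0 'k"
    by (rule poly_mapping_eqI) (simp add: lookup_laurent_flip)
  then have "bij (laurent_flip :: (int \<Rightarrow>\<^sub>0 'k) \<Rightarrow> _)"
    by (intro o_bij[of laurent_flip]) (auto simp: fun_eq_iff)
  moreover have "laurent_flip 1 = (1 :: int \<Rightarrow>\<^sub>0 'k)"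
    using laurent_flip_single[of 0 1] by simp
  ultimately have "laurent_automorphism (laurent_flip laurent_t) = (laurent_flip :: (int \<Rightarrow>\<^sub>0 'k) \<Rightarrow> _)"
    by (intro laurent_automorphism_eqI) (simp_all add: laurent_flip_add laurent_flip_mult laurent_flip_smul)
  then show ?thesis
    by (simp add: laurent_t_def laurent_t_inv_def laurent_flip_single)
qed

definition laurent_sym :: "int \<Rightarrow>\<^sub>0 'k::field"
  where "laurent_sym = laurent_t + laurent_t_inv"

lemma lookup_laurent_sym_mult:
  "Poly_Mapping.lookup (laurent_sym * p) k = Poly_Mapping.lookup p (k - 1) + Poly_Mapping.lookup p (k + 1)"
  by (simp add: laurent_sym_def laurent_t_def laurent_t_inv_def distrib_left lookup_add
     mult.commute[of _ p] lookup_mult_single_1)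

text \<open>
  \<open>(t + t\<^sup>-\<^sup>1)\<^sup>n\<close> has degree \<open>n\<close> and leading coefficient \<open>1\<close>; this triangularity gives both the
  independence of these powers and the fact that they span the symmetric Laurent polynomials.
\<close>

lemma lookup_laurent_sym_power:
  shows "\<bar>k\<bar> > int n \<Longrightarrow> Poly_Mapping.lookup (laurent_sym ^ n :: int \<Rightarrow>\<^sub>0 'k::field) k = 0"
    and "Poly_Mapping.lookup (laurent_sym ^ n :: int \<Rightarrow>\<^sub>0 'k) (int n) = 1"
proof (induction n arbitrary: k)
  case 0
  { case 1 then show ?case by (simp add: lookup_one) next
    case 2 then show ?case by simp }
next
  case (Suc n)
  { case 1 then show ?case using Suc.IH(1)[of "k - 1"] Suc.IH(1)[of "k + 1"]
      by (simp add: lookup_laurent_sym_mult) next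
    case 2 then show ?case using Suc.IH(1)[of "int n + 2"] Suc.IH(2)
      by (simp add: lookup_laurent_sym_mult add.commute) }
qed

lemma lookup_poly_at_laurent_sym:
  "\<bar>k\<bar> \<ge> int N \<Longrightarrow> Poly_Mapping.lookup (poly_at laurent_sym N d) k = 0"
  by (auto simp: poly_at_def lookup_sum lookup_laurent_sym_power)

lemma poly_at_laurent_sym_eq_0:
  "poly_at laurent_sym N d = 0 \<Longrightarrow> m < N \<Longrightarrow> d m = 0"
proof (induction N)
  case (Suc N)
  have "Poly_Mapping.lookup (poly_at laurent_sym (Suc N) d) (int N) = d N"
    by (simp add: poly_at_Suc lookup_add lookup_poly_at_laurent_sym lookup_laurent_sym_power)
  with Suc.prems(1) have N: "d N = 0" by simp
  with Suc show ?case by (cases "m = N") (simp_all add: poly_at_Suc)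
qed simp

lemma laurent_flip_sym_power:
  "laurent_flip (laurent_sym ^ n) = (laurent_sym ^ n :: int \<Rightarrow>\<^sub>0 'k::field)"
proof (induction n)
  case 0
  then show ?case using laurent_flip_single[of 0 1] by simp
next
  case (Suc n)
  have "laurent_flip laurent_sym = (laurent_sym :: int \<Rightarrow>\<^sub>0 'k)"
    by (simp add: laurent_sym_def laurent_t_def laurent_t_inv_def laurent_flip_add laurent_flip_single)
  with Suc show ?case by (simp add: laurent_flip_mult)
qed

lemma laurent_flip_poly_at: "laurent_flip (poly_at laurent_sym N d) = poly_at laurent_sym N d"
  by (induction N) (simp_all add: laurent_flip_0 poly_at_Suc laurent_flip_add laurent_flip_smul laurent_flip_sym_power)

text \<open>
  Subtract a multiple of \<open>(t + t\<^sup>-\<^sup>1)\<^sup>N\<close> to remove the coefficient of \<open>t\<^sup>N\<close>; by symmetry this removes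
  the coefficient of \<open>t\<^sup>-\<^sup>N\<close> as well.
\<close>

lemma symmetric_laurent_eq_poly_at:
  assumes "laurent_flip p = p" and "\<And>k. \<bar>k\<bar> \<ge> int N \<Longrightarrow> Poly_Mapping.lookup p k = 0"
  shows "\<exists>d. p = poly_at laurent_sym N d"
  using assms
proof (induction N arbitrary: p)
  case 0
  then have "p = 0" by (intro poly_mapping_eqI) simp
  then show ?case by simp
next
  case (Suc N)
  define c where "c = Poly_Mapping.lookup p (int N)"
  define p' where "p' = p + smul (- c) (laurent_sym ^ N)"
  have flip: "laurent_flip p' = p'"
    by (simp add: p'_def laurent_flip_add laurent_flip_smul laurent_flip_sym_power Suc.prems(1))
  have top: "Poly_Mapping.lookup p' (int N) = 0"
    by (simp add: p'_def lookup_add lookup_laurent_sym_power c_def)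
  have "Poly_Mapping.lookup p' k = 0" if "\<bar>k\<bar> \<ge> int N" for k
  proof (cases "\<bar>k\<bar> = int N")
    case True
    then have "k = int N \<or> - k = int N" by auto
    then show ?thesis using top lookup_laurent_flip[of p' k] flip by auto
  next
    case False
    then show ?thesis using that Suc.prems(2)[of k]
      by (simp add: p'_def lookup_add lookup_laurent_sym_power)
  qed
  from Suc.IH[OF flip this] obtain d where d: "p' = poly_at laurent_sym N d" by auto
  have "poly_at laurent_sym N (d(N := c)) = poly_at laurent_sym N d"
    by (simp add: poly_at_def)
  then have "p = poly_at laurent_sym (Suc N) (d(N := c))"
    using d by (simp add: poly_at_Suc p'_def smul_distribs algebra_simps)
  then show ?case by blast
qed

lemma symmetric_laurent_ex_poly_at:
  assumes "laurent_flip p = p"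
  shows "\<exists>N d. p = poly_at laurent_sym N d"
proof -
  obtain N where N: "\<And>k. k \<in> Poly_Mapping.keys p \<Longrightarrow> nat \<bar>k\<bar> < N"
    using finite_nat_set_iff_bounded[of "(\<lambda>k. nat \<bar>k\<bar>) ` Poly_Mapping.keys p"] by auto
  have "Poly_Mapping.lookup p k = 0" if "\<bar>k\<bar> \<ge> int N" for k
    using N[of k] that by (cases "k \<in> Poly_Mapping.keys p") (auto simp: not_in_keys_iff_lookup_eq_zero)
  with symmetric_laurent_eq_poly_at[OF assms] show ?thesis by blast
qed

lemma laurent_scale_poly_at:
  assumes "a \<noteq> 0"
  shows "laurent_scale a (poly_at u N d) = poly_at (laurent_scale a u) N d"
proof -
  have "laurent_scale a (u ^ n) = laurent_scale a u ^ n" for n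
    by (induction n) (simp_all add: laurent_scale_1 laurent_scale_mult[OF assms])
  then show ?thesis
    by (induction N) (simp_all add: laurent_scale_0 poly_at_Suc laurent_scale_add laurent_scale_smul)
qed

section \<open>Passing to the quotient algebra\<close>

context uq begin

definition uq_class :: "(uq_gen word \<Rightarrow>\<^sub>0 'k) \<Rightarrow> (uq_gen word \<Rightarrow>\<^sub>0 'k) set"
  where "uq_class p = uq_ideal q +>\<^bsub>free_algebra\<^esub> p"

lemma mem_uq_class: "x \<in> uq_class p \<longleftrightarrow> x \<cong>\<^sub>q p"
proof -
  have "x \<in> uq_class p \<longleftrightarrow> (\<exists>i\<in>uq_ideal q. x = i + p)"
    by (simp add: uq_class_def a_r_coset_def' free_algebra_simps)
  also have "\<dots> \<longleftrightarrow> x - p \<in> uq_ideal q"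
    by (auto intro: bexI[of _ "x - p"])
  finally show ?thesis by (simp add: cong_def)
qed

lemma uq_class_eq_iff: "uq_class p = uq_class p' \<longleftrightarrow> p \<cong>\<^sub>q p'"
  by (auto simp: set_eq_iff mem_uq_class intro: cong_trans cong_sym)

lemma Uq_g_simps:
  "carrier (Uq_g q) = range uq_class"
  "uq_class p \<otimes>\<^bsub>Uq_g q\<^esub> uq_class p' = uq_class (p * p')"
  "uq_class p \<oplus>\<^bsub>Uq_g q\<^esub> uq_class p' = uq_class (p + p')"
  "\<one>\<^bsub>Uq_g q\<^esub> = uq_class 1"
  "\<zero>\<^bsub>Uq_g q\<^esub> = uq_class 0"
  "c \<odot>\<^bsub>Uq_g q\<^esub> uq_class p = uq_class (smul c p)"
proof -
  interpret I: ideal "uq_ideal q" free_algebra by (rule ideal_uq_ideal)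
  note defs = Uq_g_def quotient_algebra_def ring.defs module.defs FactRing_def
  show "carrier (Uq_g q) = range uq_class"
    by (auto simp: defs A_RCOSETS_def' uq_class_def free_algebra_simps)
  show "uq_class p \<otimes>\<^bsub>Uq_g q\<^esub> uq_class p' = uq_class (p * p')"
    using I.rcoset_mult_add[of p p'] by (simp add: defs uq_class_def free_algebra_simps)
  show "uq_class p \<oplus>\<^bsub>Uq_g q\<^esub> uq_class p' = uq_class (p + p')"
    using I.a_rcos_sum[of p p'] by (simp add: defs uq_class_def free_algebra_simps)
  show "\<one>\<^bsub>Uq_g q\<^esub> = uq_class 1"
    by (simp add: defs uq_class_def free_algebra_simps)
  have "uq_ideal q = uq_class 0" by (auto simp: mem_uq_class cong_def)
  then show "\<zero>\<^bsub>Uq_g q\<^esub> = uq_class 0" by (simp add: defs)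
  have "c \<odot>\<^bsub>Uq_g q\<^esub> uq_class p = (\<Union>x\<in>uq_class p. uq_class (smul c x))"
    by (simp add: defs uq_class_def free_algebra_simps)
  also have "\<dots> = uq_class (smul c p)"
  proof -
    have "uq_class (smul c x) = uq_class (smul c p)" if "x \<in> uq_class p" for x
      using that by (simp add: mem_uq_class uq_class_eq_iff cong_smul)
    moreover have "p \<in> uq_class p" by (simp add: mem_uq_class)
    ultimately show ?thesis by blast
  qed
  finally show "c \<odot>\<^bsub>Uq_g q\<^esub> uq_class p = uq_class (smul c p)" .
qed

lemma uq_gen_class_eq: "uq_gen_class q g = uq_class (free_gen g)"
  by (simp add: uq_gen_class_def uq_class_def)

lemma ring_Uq_g: "ring (Uq_g q)"
proof (intro ringI abelian_groupI monoidI)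
  fix S assume "S \<in> carrier (Uq_g q)"
  then obtain p where "S = uq_class p" by (auto simp: Uq_g_simps)
  then show "\<exists>R\<in>carrier (Uq_g q). R \<oplus>\<^bsub>Uq_g q\<^esub> S = \<zero>\<^bsub>Uq_g q\<^esub>"
    by (intro bexI[of _ "uq_class (- p)"]) (simp_all add: Uq_g_simps)
qed (auto simp: Uq_g_simps algebra_simps)

lemma Uq_g_a_inv: "\<ominus>\<^bsub>Uq_g q\<^esub> uq_class p = uq_class (- p)"
proof -
  interpret ring "Uq_g q" by (rule ring_Uq_g)
  show ?thesis by (rule minus_equality) (simp_all add: Uq_g_simps)
qed

lemma letters_in_closed:
  shows letters_in_1: "1 \<in> letters_in A"
    and letters_in_gen: "g \<in> A \<Longrightarrow> free_gen g \<in> letters_in A"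
    and letters_in_add: "p \<in> letters_in A \<Longrightarrow> p' \<in> letters_in A \<Longrightarrow> p + p' \<in> letters_in A"
    and letters_in_mult: "p \<in> letters_in A \<Longrightarrow> p' \<in> letters_in A \<Longrightarrow> p * p' \<in> letters_in A"
    and letters_in_smul: "p \<in> letters_in A \<Longrightarrow> smul c p \<in> letters_in A"
proof -
  show "1 \<in> letters_in A" by (simp add: letters_in_def zero_word_def)
  show "g \<in> A \<Longrightarrow> free_gen g \<in> letters_in A" by (simp add: letters_in_def free_gen_def)
  show "p \<in> letters_in A \<Longrightarrow> p' \<in> letters_in A \<Longrightarrow> p + p' \<in> letters_in A"
    using Poly_Mapping.keys_add[of p p'] by (auto simp: letters_in_def)
  show "p \<in> letters_in A \<Longrightarrow> p' \<in> letters_in A \<Longrightarrow> p * p' \<in> letters_in A"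
    using keys_mult[of p p'] by (fastforce simp: letters_in_def plus_word_def)
  show "p \<in> letters_in A \<Longrightarrow> smul c p \<in> letters_in A"
    by (auto simp: letters_in_def in_keys_iff)
qed

lemma letters_in_power: "p \<in> letters_in A \<Longrightarrow> p ^ n \<in> letters_in A"
  by (induction n) (auto intro: letters_in_closed)

text \<open>
  This turns statements about the carriers of \<open>U\<^sub>q(k)\<close> and \<open>O\<^sub>q(K \ U)\<close> into inductions over words.
\<close>

lemma generated_subalgebra_eq:
  "generated_subalgebra (Uq_g q) (uq_gen_class q ` A) = uq_class ` letters_in A"
proof
  let ?H = "uq_gen_class q ` A \<union> {c \<odot>\<^bsub>Uq_g q\<^esub> \<one>\<^bsub>Uq_g q\<^esub> | c. True}"
  show "generated_subalgebra (Uq_g q) (uq_gen_class q ` A) \<subseteq> uq_class ` letters_in A"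
  proof
    fix S assume "S \<in> generated_subalgebra (Uq_g q) (uq_gen_class q ` A)"
    then have "S \<in> generate_ring (Uq_g q) ?H" by (simp add: generated_subalgebra_def)
    then show "S \<in> uq_class ` letters_in A"
    proof induction
      case one
      then show ?case by (auto simp: Uq_g_simps intro: letters_in_1)
    next
      case (incl h)
      then show ?case
        by (auto simp: Uq_g_simps uq_gen_class_eq intro: letters_in_1 letters_in_gen letters_in_smul)
    next
      case (a_inv h)
      then obtain p where p: "p \<in> letters_in A" "h = uq_class p" by auto
      from letters_in_smul[OF p(1), of "-1"] show ?case
        by (auto simp: p(2) Uq_g_a_inv smul_distribs)
    qed (auto simp: Uq_g_simps intro: letters_in_add letters_in_mult)
  qed
  show "uq_class ` letters_in A \<subseteq> generated_subalgebra (Uq_g q) (uq_gen_class q ` A)"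
  proof clarify
    fix p assume "p \<in> letters_in A"
    then have "uq_class p \<in> generate_ring (Uq_g q) ?H"
    proof (induction rule: letters_in_induct)
      case one
      show ?case using generate_ring.one[of "Uq_g q"] by (simp add: Uq_g_simps)
    next
      case (mult_gen g p)
      have "uq_class (free_gen g) \<in> generate_ring (Uq_g q) ?H"
        using mult_gen(1) by (intro generate_ring.incl) (auto simp: uq_gen_class_eq)
      from generate_ring.eng_mult[OF this mult_gen(2)] show ?case by (simp add: Uq_g_simps)
    next
      case (add p p')
      from generate_ring.eng_add[OF this] show ?case by (simp add: Uq_g_simps)
    next
      case (scale c p)
      have "uq_class (smul c 1) \<in> generate_ring (Uq_g q) ?H"
        by (intro generate_ring.incl) (auto simp: Uq_g_simps)
      from generate_ring.eng_mult[OF this scale] show ?case by (simp add: Uq_g_simps)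
    qed
    then show "uq_class p \<in> generated_subalgebra (Uq_g q) (uq_gen_class q ` A)"
      by (simp add: generated_subalgebra_def)
  qed
qed

lemma carrier_Uq_k: "carrier (Uq_k q) = uq_class ` letters_in {GTheta}"
  using generated_subalgebra_eq[of "{GTheta}"] by (simp add: Uq_k_def)

lemma carrier_Oq_KU: "carrier (Oq_KU q) = uq_class ` letters_in {GX, GY, GZ}"
  using generated_subalgebra_eq[of "{GX, GY, GZ}"] by (simp add: Oq_KU_def)

definition descend :: "((uq_gen word \<Rightarrow>\<^sub>0 'k) \<Rightarrow> 'b) \<Rightarrow> (uq_gen word \<Rightarrow>\<^sub>0 'k) set \<Rightarrow> 'b"
  where "descend f S = f (SOME p. uq_class p = S)"

lemma descend_uq_class:
  assumes "\<And>p p'. p \<cong>\<^sub>q p' \<Longrightarrow> f p = f p'"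
  shows "descend f (uq_class p) = f p"
proof -
  have "uq_class (SOME p'. uq_class p' = uq_class p) = uq_class p" by (rule someI) simp
  then show ?thesis unfolding descend_def by (intro assms) (simp add: uq_class_eq_iff)
qed

lemma base_algebra_simps:
  "carrier base_algebra = UNIV"
  "x \<otimes>\<^bsub>base_algebra\<^esub> y = x * y"
  "x \<oplus>\<^bsub>base_algebra\<^esub> y = x + y"
  "\<one>\<^bsub>base_algebra\<^esub> = 1"
  "c \<odot>\<^bsub>base_algebra\<^esub> x = c * x"
  by (simp_all add: base_algebra_def algebra_of_type_def ring.defs module.defs
        ring_of_type_algebra_def)

lemma algebra_hom_unique:
  assumes h: "h \<in> algebra_hom (Uq_g q\<lparr>carrier := uq_class ` letters_in A\<rparr>) M"
    and h': "h' \<in> algebra_hom (Uq_g q\<lparr>carrier := uq_class ` letters_in A\<rparr>) M"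
    and eq: "\<And>g. g \<in> A \<Longrightarrow> h (uq_class (free_gen g)) = h' (uq_class (free_gen g))"
  shows "h = h'"
proof (rule extensionalityI[of _ "uq_class ` letters_in A"])
  show "h \<in> extensional (uq_class ` letters_in A)" "h' \<in> extensional (uq_class ` letters_in A)"
    using h h' by (auto simp: algebra_hom_def linear_maps_def PiE_def)
  fix S assume "S \<in> uq_class ` letters_in A"
  then obtain p where p: "p \<in> letters_in A" "S = uq_class p" by auto
  have hom: "f (uq_class (p + p')) = f (uq_class p) \<oplus>\<^bsub>M\<^esub> f (uq_class p')"
      "f (uq_class (p * p')) = f (uq_class p) \<otimes>\<^bsub>M\<^esub> f (uq_class p')"
    if "f \<in> algebra_hom (Uq_g q\<lparr>carrier := uq_class ` letters_in A\<rparr>) M"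
      "p \<in> letters_in A" "p' \<in> letters_in A" for f p p'
    using that by (auto simp: algebra_hom_def linear_maps_def ring_hom_def simp flip: Uq_g_simps)
  have hom_scale: "f (uq_class (smul c p)) = c \<odot>\<^bsub>M\<^esub> f (uq_class p)"
    if "f \<in> algebra_hom (Uq_g q\<lparr>carrier := uq_class ` letters_in A\<rparr>) M" "p \<in> letters_in A" for f p c
    using that by (auto simp: algebra_hom_def linear_maps_def simp flip: Uq_g_simps)
  have hom_one: "f (uq_class 1) = \<one>\<^bsub>M\<^esub>"
    if "f \<in> algebra_hom (Uq_g q\<lparr>carrier := uq_class ` letters_in A\<rparr>) M" for f
    using that by (auto simp: algebra_hom_def ring_hom_def simp flip: Uq_g_simps)
  from p(1) have "p \<in> letters_in A \<and> h (uq_class p) = h' (uq_class p)"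
    by (induction rule: letters_in_induct)
      (use eq in \<open>simp_all add: letters_in_closed hom[OF h] hom[OF h'] hom_one[OF h] hom_one[OF h']
        hom_scale[OF h] hom_scale[OF h']\<close>)
  then show "h S = h' S" by (simp add: p(2))
qed

text \<open>
  On polynomials in \<open>\<theta>\<close> the map \<open>gamma_hat\<close> takes constant values (multiples of \<open>t\<^sup>0\<close>), since it annihilates
  every multiple of \<open>\<theta>\<close>; the constant is the required character.
\<close>

lemma zeta0_uq_class:
  assumes "p \<in> letters_in {GTheta}"
  shows "zeta0 q (uq_class p) = Poly_Mapping.lookup (gamma_hat p) 0"
proof -
  let ?z = "\<lambda>p. Poly_Mapping.lookup (gamma_hat p) 0"
  let ?f = "restrict (descend ?z) (uq_class ` letters_in {GTheta})"
  have desc: "descend ?z (uq_class p) = ?z p" for p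
    by (rule descend_uq_class) (simp add: gamma_hat_cong)
  have Uq_k: "Uq_k q = Uq_g q\<lparr>carrier := uq_class ` letters_in {GTheta}\<rparr>"
    using carrier_Uq_k by (simp add: Uq_k_def)
  have f: "?f \<in> algebra_hom (Uq_k q) base_algebra"
    unfolding Uq_k algebra_hom_def linear_maps_def ring_hom_def
    by (auto simp: base_algebra_simps Uq_g_simps desc letters_in_closed gamma_hat_add gamma_hat_smul
      gamma_hat_1 lookup_add gamma_hat_letters_Theta)
  have gTheta: "?f (uq_class gTheta) = 0"
    using gamma_hat_Theta[of 1] by (simp add: desc letters_in_gen)
  have "zeta0 q = ?f"
    unfolding zeta0_def uq_gen_class_eq
  proof (rule the_equality)
    show "?f \<in> algebra_hom (Uq_k q) base_algebra \<and> ?f (uq_class gTheta) = 0"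
      using f gTheta by blast
    show "h = ?f" if "h \<in> algebra_hom (Uq_k q) base_algebra \<and> h (uq_class gTheta) = 0" for h
      using that f gTheta unfolding Uq_k by (intro algebra_hom_unique) auto
  qed
  then show ?thesis using assms by (simp add: desc)
qed

lemma ab_uq_class:
  assumes "p \<in> letters_in {GX, GY, GZ}"
  shows "ab q (uq_class p) = gamma_hat p"
proof -
  let ?A = "{GX, GY, GZ}"
  let ?f = "restrict (descend gamma_hat) (uq_class ` letters_in ?A)"
  have desc: "descend gamma_hat (uq_class p) = gamma_hat p" for p
    by (rule descend_uq_class) (rule gamma_hat_cong)
  have Oq: "Oq_KU q = Uq_g q\<lparr>carrier := uq_class ` letters_in ?A\<rparr>"
    using carrier_Oq_KU by (simp add: Oq_KU_def)
  have f: "?f \<in> algebra_hom (Oq_KU q) laurent_algebra"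
    unfolding Oq algebra_hom_def linear_maps_def ring_hom_def
    by (auto simp: laurent_algebra_simps Uq_g_simps desc letters_in_closed gamma_hat_add gamma_hat_smul
      gamma_hat_1 gamma_hat_mult)
  have gen: "?f (uq_class gX) = laurent_t" "?f (uq_class gY) = laurent_t_inv" "?f (uq_class gZ) = 0"
    using gamma_hat_X[of 1] gamma_hat_Y[of 1] gamma_hat_Z[of 1]
    by (simp_all add: desc letters_in_gen gamma_hat_1)
  have "ab q = ?f"
    unfolding ab_def uq_gen_class_eq
  proof (rule the_equality)
    show "?f \<in> algebra_hom (Oq_KU q) laurent_algebra \<and> ?f (uq_class gX) = laurent_t \<and>
        ?f (uq_class gY) = laurent_t_inv \<and> ?f (uq_class gZ) = 0"
      using f gen by blast
    show "h = ?f" if "h \<in> algebra_hom (Oq_KU q) laurent_algebra \<and> h (uq_class gX) = laurent_t \<and>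
        h (uq_class gY) = laurent_t_inv \<and> h (uq_class gZ) = 0" for h
      using that f gen unfolding Oq by (intro algebra_hom_unique) auto
  qed
  then show ?thesis using assms by (simp add: desc)
qed

lemma pbw_monomial_factors: "\<exists>x\<in>letters_in {GTheta}. \<exists>y\<in>letters_in {GX, GY, GZ}. pbw_monomial s = x * y"
proof -
  obtain n a k where s: "s = (n, a, k)" by (cases s)
  have "xy_power k \<in> letters_in {GX, GY, GZ}"
    by (simp add: xy_power_def letters_in_power letters_in_gen)
  then have "gZ ^ a * xy_power k \<in> letters_in {GX, GY, GZ}"
    by (simp add: letters_in_mult letters_in_power letters_in_gen)
  moreover have "gTheta ^ n \<in> letters_in {GTheta}" by (simp add: letters_in_power letters_in_gen)
  ultimately show ?thesis by (auto simp: s pbw_monomial_def)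
qed

text \<open>
  Uniqueness holds because the ordered monomials are products of an element of \<open>U\<^sub>q(k)\<close> and an element
  of \<open>O\<^sub>q(K \ U)\<close>.
\<close>

lemma gamma_map_uq_class: "gamma_map q (uq_class p) = gamma_hat p"
proof -
  let ?f = "restrict (descend gamma_hat) (range uq_class)"
  have desc: "descend gamma_hat (uq_class p) = gamma_hat p" for p
    by (rule descend_uq_class) (rule gamma_hat_cong)
  have f: "?f \<in> linear_maps (Uq_g q) laurent_algebra"
    by (auto simp: linear_maps_def laurent_algebra_simps Uq_g_simps desc gamma_hat_add gamma_hat_smul)
  have product: "?f (S \<otimes>\<^bsub>Uq_g q\<^esub> R) = zeta0 q S \<odot>\<^bsub>laurent_algebra\<^esub> ab q R"
    if "S \<in> carrier (Uq_k q)" "R \<in> carrier (Oq_KU q)" for S R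
    using that
    by (auto simp: carrier_Uq_k carrier_Oq_KU Uq_g_simps desc zeta0_uq_class ab_uq_class laurent_algebra_simps
      gamma_hat_letters_Theta)
  have "gamma_map q = ?f"
    unfolding gamma_map_def
  proof (rule the_equality)
    show "?f \<in> linear_maps (Uq_g q) laurent_algebra \<and> (\<forall>S\<in>carrier (Uq_k q). \<forall>R\<in>carrier (Oq_KU q).
        ?f (S \<otimes>\<^bsub>Uq_g q\<^esub> R) = zeta0 q S \<odot>\<^bsub>laurent_algebra\<^esub> ab q R)"
      using f product by blast
    fix h assume h: "h \<in> linear_maps (Uq_g q) laurent_algebra \<and> (\<forall>S\<in>carrier (Uq_k q). \<forall>R\<in>carrier (Oq_KU q).
        h (S \<otimes>\<^bsub>Uq_g q\<^esub> R) = zeta0 q S \<odot>\<^bsub>laurent_algebra\<^esub> ab q R)"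
    have lin: "h (uq_class (p + p')) = h (uq_class p) + h (uq_class p')"
        "h (uq_class (smul c p)) = smul c (h (uq_class p))" for p p' c
      using h by (auto simp: linear_maps_def laurent_algebra_simps Uq_g_simps)
    have "h (uq_class p) = gamma_hat p" for p
      using pbw_span_UNIV[of p]
    proof induction
      case (basis s)
      obtain x y where xy: "x \<in> letters_in {GTheta}" "y \<in> letters_in {GX, GY, GZ}" "pbw_monomial s = x * y"
        using pbw_monomial_factors by blast
      then have "h (uq_class x \<otimes>\<^bsub>Uq_g q\<^esub> uq_class y) = zeta0 q (uq_class x) \<odot>\<^bsub>laurent_algebra\<^esub> ab q (uq_class y)"
        using h by (auto simp: carrier_Uq_k carrier_Oq_KU)
      with xy show ?case
        by (simp add: Uq_g_simps zeta0_uq_class ab_uq_class laurent_algebra_simps gamma_hat_letters_Theta)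
    next
      case (congruent p p')
      then have "uq_class p' = uq_class p" "gamma_hat p' = gamma_hat p"
        by (simp_all add: uq_class_eq_iff gamma_hat_cong)
      with congruent show ?case by simp
    qed (simp_all add: lin gamma_hat_add gamma_hat_smul)
    moreover have "h \<in> extensional (range uq_class)"
      using h by (auto simp: linear_maps_def Uq_g_simps PiE_def)
    ultimately show "h = ?f"
      by (intro extensionalityI[of _ "range uq_class"]) (auto simp: desc)
  qed
  then show ?thesis by (simp add: desc)
qed

definition central :: "(uq_gen word \<Rightarrow>\<^sub>0 'k) \<Rightarrow> bool"
  where "central z \<longleftrightarrow> (\<forall>p. z * p \<cong>\<^sub>q p * z)"

lemma carrier_Zq_g: "carrier (Zq_g q) = uq_class ` Collect central"
  by (auto simp: Zq_g_def algebra_center_def Uq_g_simps central_def simp flip: uq_class_eq_iff)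

text \<open>
  For \<open>p = x y\<close> with \<open>x\<close> a polynomial in \<open>\<theta>\<close> and \<open>y\<close> in \<open>X, Y, Z\<close>, write \<open>x y z = x z y\<close>: then \<open>x\<close>
  acts by the character on the left and \<open>y\<close> multiplicatively on the right.
\<close>

lemma gamma_hat_mult_central:
  assumes "central z"
  shows "gamma_hat (p * z) = gamma_hat p * gamma_hat z"
  using pbw_span_UNIV[of p]
proof induction
  case (basis s)
  obtain x y where xy: "x \<in> letters_in {GTheta}" "y \<in> letters_in {GX, GY, GZ}" "pbw_monomial s = x * y"
    using pbw_monomial_factors by blast
  have "y * z \<cong>\<^sub>q z * y" using assms by (auto simp: central_def intro: cong_sym)
  then have "gamma_hat (y * z) = gamma_hat y * gamma_hat z"
    using gamma_hat_mult[OF xy(2), of z] gamma_hat_cong by (simp add: mult.commute)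
  with xy show ?case by (simp add: mult.assoc gamma_hat_letters_Theta)
next
  case (congruent p p')
  then show ?case using gamma_hat_cong[OF congruent(2)] gamma_hat_cong[OF cong_mult_right[OF congruent(2)]]
    by simp
qed (simp_all add: gamma_hat_add gamma_hat_smul distrib_right)

lemma central_closed:
  shows central_1: "central 1"
    and central_add: "central z \<Longrightarrow> central z' \<Longrightarrow> central (z + z')"
    and central_smul: "central z \<Longrightarrow> central (smul c z)"
    and central_mult: "central z \<Longrightarrow> central z' \<Longrightarrow> central (z * z')"
proof -
  show "central 1" by (simp add: central_def)
  show "central z \<Longrightarrow> central z' \<Longrightarrow> central (z + z')"
    by (auto simp: central_def distrib_left distrib_right intro: cong_add)
  show "central z \<Longrightarrow> central (smul c z)"
    by (auto simp: central_def intro: cong_smul)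
  show "central (z * z')" if "central z" "central z'"
    unfolding central_def
  proof
    fix p
    have "z * z' * p \<cong>\<^sub>q z * (p * z')"
      using that(2) by (auto simp: central_def mult.assoc intro: cong_mult_left)
    also have "z * (p * z') \<cong>\<^sub>q p * z * z'"
      using that(1) by (auto simp: central_def simp flip: mult.assoc intro: cong_mult_right)
    finally show "z * z' * p \<cong>\<^sub>q p * (z * z')" by (simp add: mult.assoc)
  qed
qed

lemma central_Casimir_power: "central (Casimir ^ n)"
proof -
  have "central Casimir" by (simp add: central_def Casimir_central)
  then show ?thesis by (induction n) (auto intro: central_1 central_mult)
qed

lemma central_poly_at_Casimir: "central (poly_at Casimir N d)"
proof (induction N)
  case 0
  then show ?case by (simp add: central_def)
next
  case (Suc N)
  then show ?case by (auto simp: poly_at_Suc intro: central_add central_smul central_Casimir_power)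
qed

lemma gamma_tilde_uq_class: "gamma_tilde q (uq_class p) = laurent_scale (inverse q) (gamma_hat p)"
  by (simp add: gamma_tilde_def sigma_map_eq gamma_map_uq_class)

lemma gamma_hat_Casimir: "laurent_scale (inverse q) (gamma_hat Casimir) = laurent_sym"
proof -
  have "gamma_hat Casimir = smul q laurent_t + smul (inverse q) laurent_t_inv"
    using gamma_hat_X[of 1] gamma_hat_Y[of 1] gamma_hat_Theta[of gZ]
    by (simp add: Casimir_def gamma_hat_add gamma_hat_smul gamma_hat_1)
  then show ?thesis
    by (simp add: laurent_sym_def laurent_t_def laurent_t_inv_def smul_single laurent_scale_add
      laurent_scale_single)
qed

lemma gamma_tilde_poly_at_Casimir:
  "gamma_tilde q (uq_class (poly_at Casimir N d)) = poly_at laurent_sym N d"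
proof -
  have "gamma_hat (Casimir ^ n) = gamma_hat Casimir ^ n" for n
  proof (induction n)
    case (Suc n)
    then show ?case using gamma_hat_mult_central[OF central_Casimir_power] by simp
  qed (simp add: gamma_hat_1)
  then have "gamma_hat (poly_at Casimir N d) = poly_at (gamma_hat Casimir) N d"
    by (induction N) (simp_all add: gamma_hat_0 poly_at_Suc gamma_hat_add gamma_hat_smul)
  then show ?thesis by (simp add: gamma_tilde_uq_class laurent_scale_poly_at gamma_hat_Casimir)
qed

lemma carrier_symmetric: "carrier symmetric_laurent_algebra = range (\<lambda>(N, d). poly_at laurent_sym N d)"
  using symmetric_laurent_ex_poly_at
  by (auto simp: symmetric_laurent_algebra_def laurent_automorphism_t_inv laurent_flip_poly_at image_iff)

lemma center_eq: "carrier (Zq_g q) = range (\<lambda>(N, d). uq_class (poly_at Casimir N d))"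
proof -
  have "\<exists>N d. uq_class z = uq_class (poly_at Casimir N d)" if "central z" for z
    unfolding uq_class_eq_iff by (rule central_in_Casimir) (use that in \<open>auto simp: central_def\<close>)
  then show ?thesis
    by (auto simp: carrier_Zq_g central_poly_at_Casimir image_iff)
qed

text \<open>
  Centre and target are the polynomials in \<open>\<Omega>\<close> and in \<open>t + t\<^sup>-\<^sup>1\<close>, and the map matches them
  coefficient by coefficient; it is injective since the powers of \<open>t + t\<^sup>-\<^sup>1\<close> are independent.
\<close>

theorem gamma_tilde_iso:
  "restrict (gamma_tilde q) (carrier (Zq_g q)) \<in> algebra_iso (Zq_g q) symmetric_laurent_algebra"
proof -
  let ?g = "gamma_tilde q" and ?Z = "carrier (Zq_g q)"
  have g_simps: "?g (uq_class (p + p')) = ?g (uq_class p) + ?g (uq_class p')"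
      "?g (uq_class (smul c p)) = smul c (?g (uq_class p))"
      "?g (uq_class 1) = 1" for p p' c
    by (simp_all add: gamma_tilde_uq_class gamma_hat_add gamma_hat_smul gamma_hat_1 laurent_scale_add
        laurent_scale_smul laurent_scale_1)
  have g_mult: "?g (uq_class (p * z)) = ?g (uq_class p) * ?g (uq_class z)" if "central z" for p z
    by (simp add: gamma_tilde_uq_class gamma_hat_mult_central[OF that] laurent_scale_mult)
  have image: "?g ` ?Z = carrier symmetric_laurent_algebra"
    by (simp add: center_eq carrier_symmetric image_image case_prod_unfold gamma_tilde_poly_at_Casimir)
  have ops: "\<one>\<^bsub>Zq_g q\<^esub> = uq_class 1" "uq_class p \<otimes>\<^bsub>Zq_g q\<^esub> uq_class p' = uq_class (p * p')"
      "uq_class p \<oplus>\<^bsub>Zq_g q\<^esub> uq_class p' = uq_class (p + p')" "c \<odot>\<^bsub>Zq_g q\<^esub> uq_class p = uq_class (smul c p)" for p p' c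
    by (simp_all add: Zq_g_def Uq_g_simps)
  have ops': "\<one>\<^bsub>symmetric_laurent_algebra\<^esub> = 1" "x \<otimes>\<^bsub>symmetric_laurent_algebra\<^esub> y = x * y"
      "x \<oplus>\<^bsub>symmetric_laurent_algebra\<^esub> y = x + y" "c \<odot>\<^bsub>symmetric_laurent_algebra\<^esub> x = smul c x"
    for x y :: "int \<Rightarrow>\<^sub>0 'k" and c
    by (simp_all add: symmetric_laurent_algebra_def laurent_algebra_simps)
  have hom: "restrict ?g ?Z \<in> algebra_hom (Zq_g q) symmetric_laurent_algebra"
    unfolding algebra_hom_def linear_maps_def ring_hom_def using image
    by (auto simp: carrier_Zq_g ops ops' g_simps g_mult central_closed)
  have "inj_on ?g ?Z"
  proof (rule inj_onI)
    fix S R assume "S \<in> ?Z" "R \<in> ?Z" and eq: "?g S = ?g R"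
    then obtain z z' where z: "central z" "central z'" "S = uq_class z" "R = uq_class z'"
      by (auto simp: carrier_Zq_g)
    let ?d = "z + smul (- 1) z'"
    have "central ?d" using z by (simp add: central_closed)
    then obtain N d where d: "?d \<cong>\<^sub>q poly_at Casimir N d"
      using central_in_Casimir[of ?d] by (auto simp: central_def)
    then have "poly_at laurent_sym N d = ?g (uq_class ?d)"
      by (metis uq_class_eq_iff gamma_tilde_poly_at_Casimir)
    also have "\<dots> = 0" using eq by (simp only: g_simps z) (simp add: smul_distribs)
    finally have "d m = 0" if "m < N" for m
      using poly_at_laurent_sym_eq_0 that by blast
    then have "poly_at Casimir N d = 0" by (simp add: poly_at_def)
    with d show "S = R" by (simp add: z uq_class_eq_iff cong_def smul_distribs)
  qed
  then have "bij_betw (restrict ?g ?Z) ?Z (carrier symmetric_laurent_algebra)"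
    using image by (simp add: bij_betw_def)
  with hom show ?thesis by (simp add: algebra_iso_def)
qed

end

theorem theorem3p5:
  fixes emb :: "complex \<Rightarrow> 'k::field" and star :: "'k \<Rightarrow> 'k" and q :: 'k
  assumes "involutive_extension emb star"
    and "q \<noteq> 0"
    and "\<And>n::nat. n > 0 \<Longrightarrow> q ^ n \<noteq> 1"
    and "\<exists>r. r\<^sup>2 = q"
    and "\<And>r. r\<^sup>2 = q \<Longrightarrow> star r = r"
  shows "restrict (gamma_tilde q) (carrier (Zq_g q))
    \<in> algebra_iso (Zq_g q) symmetric_laurent_algebra"
proof -
  interpret uq q using assms(2,3) by unfold_locales
  show ?thesis by (rule gamma_tilde_iso)
qed

end
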